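(* Let $X$ be a finite tripartite triangle complex on $n$ vertices in which every vertex has degree $k_0$ and every edge lies in exactly $k_1$ triangles, and suppose that \[ \mathrm{Spec}\,\Delta_0^+|_{Z_0}\subseteq[k_0-\mu_0,k_0+\mu_0]\cup\{\tfrac{3k_0}{2}\},\qquad \mathrm{Spec}\,\Delta_1^+|_{Z_1}\subseteq[k_1-\mu_1,k_1+\mu_1]\cup[2k_1-\mu_1,2k_1+\mu_1]\cup\{3k_1\}. \] Let $A,B,C,D$ be pairwise disjoint sets of vertices of sizes $a,b,c,d$ such that each of $A\cup D$, $B$ and $C$ is contained in a different block of the three-partition of $X$. Then \[ \left|\,|F^2(A,B,C,D)|-\frac{27k_0k_1^2abcd}{2n^3}\right|\leq\frac{6\mu_0k_1^2\sqrt{abcd}}{k_0n}\left(\frac{3k_0(\sqrt{ab}+\sqrt{cd})}{2n}+\mu_0\right)+\left[\frac{2k_1^2\mu_0}{k_0}+(k_1+\mu_1)\mu_1\right]\sqrt[4]{abcd}\,\sqrt{\left(\tfrac{3k_0\sqrt{ab}}{2n}+\mu_0\right)\left(\tfrac{3k_0\sqrt{cd}}{2n}+\mu_0\right)}. \]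
   Context: A triangle complex is a simplicial complex of dimension $2$; it is tripartite if its vertex set can be partitioned into three blocks such that every triangle has one vertex in each block. Simplicial notation: $\Omega^i$ = skew-symmetric complex functions on oriented $i$-cells with $\langle f,g\rangle=\sum_{\sigma\in X^i}f(\sigma)\overline{g(\sigma)}$, $\Omega^{-1}=\mathbb{C}$; $(\partial_if)(\sigma)=\sum_{v:v\sigma\in X^i}f(v\sigma)$ (so $\partial_0f=\sum_vf(v)$), $\delta_i=\partial_i^*$; $\Delta_i^+=\partial_{i+1}\delta_{i+1}$ ($\Delta_0^+$ is the graph Laplacian); $Z_i=\ker\partial_i$. $F^2(A,B,C,D)$ is the set of ordered pairs $(t,t')$ of triangles with $t$ having one vertex in each of $A,B,C$, $t'$ having one vertex in each of $B,C,D$, and $t\cap t'$ an edge. *)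

theory Defs
  imports "HOL-Analysis.Analysis"
begin

text \<open>A finite simplicial complex of dimension 2 (triangle complex), given by its set of
  (nonempty) faces.  Oriented cells are represented as ordered tuples of distinct vertices.\<close>

definition triangle_complex :: "'v set set \<Rightarrow> bool" where
  "triangle_complex X \<longleftrightarrow> finite X \<and>
     (\<forall>\<sigma>\<in>X. \<sigma> \<noteq> {} \<and> finite \<sigma> \<and> card \<sigma> \<le> 3) \<and>
     (\<forall>\<sigma>\<in>X. \<forall>\<tau>. \<tau> \<subseteq> \<sigma> \<and> \<tau> \<noteq> {} \<longrightarrow> \<tau> \<in> X) \<and>
     (\<exists>\<sigma>\<in>X. card \<sigma> = 3)"

definition cverts :: "'v set set \<Rightarrow> 'v set" where
  "cverts X = {v. {v} \<in> X}"

definition cedges :: "'v set set \<Rightarrow> 'v set set" where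
  "cedges X = {\<sigma>\<in>X. card \<sigma> = 2}"

definition ctris :: "'v set set \<Rightarrow> 'v set set" where
  "ctris X = {\<sigma>\<in>X. card \<sigma> = 3}"

definition vdeg :: "'v set set \<Rightarrow> 'v \<Rightarrow> nat" where
  "vdeg X v = card {e\<in>cedges X. v \<in> e}"

definition edeg :: "'v set set \<Rightarrow> 'v set \<Rightarrow> nat" where
  "edeg X e = card {t\<in>ctris X. e \<subseteq> t}"

definition tripartition :: "'v set set \<Rightarrow> 'v set \<Rightarrow> 'v set \<Rightarrow> 'v set \<Rightarrow> bool" where
  "tripartition X P1 P2 P3 \<longleftrightarrow>
     P1 \<union> P2 \<union> P3 = cverts X \<and> P1 \<inter> P2 = {} \<and> P1 \<inter> P3 = {} \<and> P2 \<inter> P3 = {} \<and>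
     (\<forall>t\<in>ctris X. card (t \<inter> P1) = 1 \<and> card (t \<inter> P2) = 1 \<and> card (t \<inter> P3) = 1)"

definition Omega0 :: "'v set set \<Rightarrow> ('v \<Rightarrow> complex) set" where
  "Omega0 X = {f. \<forall>v. {v} \<notin> X \<longrightarrow> f v = 0}"

definition Omega1 :: "'v set set \<Rightarrow> ('v \<Rightarrow> 'v \<Rightarrow> complex) set" where
  "Omega1 X = {f. (\<forall>u w. \<not> (u \<noteq> w \<and> {u, w} \<in> X) \<longrightarrow> f u w = 0) \<and>
                  (\<forall>u w. f w u = - f u w)}"

definition Omega2 :: "'v set set \<Rightarrow> ('v \<Rightarrow> 'v \<Rightarrow> 'v \<Rightarrow> complex) set" where
  "Omega2 X = {f. (\<forall>u v w. \<not> (distinct [u, v, w] \<and> {u, v, w} \<in> X) \<longrightarrow> f u v w = 0) \<and>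
                  (\<forall>u v w. f v u w = - f u v w) \<and> (\<forall>u v w. f u w v = - f u v w)}"

definition bd0 :: "'v set set \<Rightarrow> ('v \<Rightarrow> complex) \<Rightarrow> complex" where
  "bd0 X f = (\<Sum>v\<in>cverts X. f v)"

definition bd1 :: "'v set set \<Rightarrow> ('v \<Rightarrow> 'v \<Rightarrow> complex) \<Rightarrow> 'v \<Rightarrow> complex" where
  "bd1 X f u = (\<Sum>v\<in>{v. v \<noteq> u \<and> {v, u} \<in> X}. f v u)"

definition bd2 :: "'v set set \<Rightarrow> ('v \<Rightarrow> 'v \<Rightarrow> 'v \<Rightarrow> complex) \<Rightarrow> 'v \<Rightarrow> 'v \<Rightarrow> complex" where
  "bd2 X f u w = (\<Sum>v\<in>{v. distinct [v, u, w] \<and> {v, u, w} \<in> X}. f v u w)"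

text \<open>Coboundary operators \<open>\<delta>_i = \<partial>_i^*\<close> (adjoints w.r.t. the inner product summing over
  cells, one orientation each), written out explicitly.\<close>
definition cbd1 :: "'v set set \<Rightarrow> ('v \<Rightarrow> complex) \<Rightarrow> 'v \<Rightarrow> 'v \<Rightarrow> complex" where
  "cbd1 X g u w = (if u \<noteq> w \<and> {u, w} \<in> X then g w - g u else 0)"

definition cbd2 :: "'v set set \<Rightarrow> ('v \<Rightarrow> 'v \<Rightarrow> complex) \<Rightarrow> 'v \<Rightarrow> 'v \<Rightarrow> 'v \<Rightarrow> complex" where
  "cbd2 X g u v w = (if distinct [u, v, w] \<and> {u, v, w} \<in> X then g v w - g u w + g u v else 0)"

definition uLap0 :: "'v set set \<Rightarrow> ('v \<Rightarrow> complex) \<Rightarrow> 'v \<Rightarrow> complex" where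
  "uLap0 X f = bd1 X (cbd1 X f)"

definition uLap1 :: "'v set set \<Rightarrow> ('v \<Rightarrow> 'v \<Rightarrow> complex) \<Rightarrow> 'v \<Rightarrow> 'v \<Rightarrow> complex" where
  "uLap1 X f = bd2 X (cbd2 X f)"

text \<open>Spectra of the restrictions \<open>\<Delta>_i^+|_{Z_i}\<close>, \<open>Z_i = ker \<partial>_i\<close> (finite-dimensional, so the
  spectrum is the set of eigenvalues).\<close>
definition spec_Z0 :: "'v set set \<Rightarrow> complex set" where
  "spec_Z0 X = {ev. \<exists>f\<in>Omega0 X. bd0 X f = 0 \<and> f \<noteq> (\<lambda>_. 0) \<and> uLap0 X f = (\<lambda>v. ev * f v)}"

definition spec_Z1 :: "'v set set \<Rightarrow> complex set" where
  "spec_Z1 X = {ev. \<exists>f\<in>Omega1 X. bd1 X f = (\<lambda>_. 0) \<and> f \<noteq> (\<lambda>_ _. 0) \<and>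
                    uLap1 X f = (\<lambda>u w. ev * f u w)}"

definition F2 :: "'v set set \<Rightarrow> 'v set \<Rightarrow> 'v set \<Rightarrow> 'v set \<Rightarrow> 'v set \<Rightarrow> ('v set \<times> 'v set) set" where
  "F2 X A B C D = {(t, t'). t \<in> ctris X \<and> t' \<in> ctris X \<and>
      card (t \<inter> A) = 1 \<and> card (t \<inter> B) = 1 \<and> card (t \<inter> C) = 1 \<and>
      card (t' \<inter> B) = 1 \<and> card (t' \<inter> C) = 1 \<and> card (t' \<inter> D) = 1 \<and>
      t \<inter> t' \<in> cedges X}"

end

theory Submission
  imports Defs
begin

text \<open>
  Orient every edge cyclically along the three blocks. One-forms then become functions on arcs,
  and \<open>\<Delta>\<^sub>1\<^sup>+ = k\<^sub>1 + M\<close> where \<open>M\<close> is the adjacency of arcs in a common triangle. If \<open>f\<close>, \<open>g\<close>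
  are the indicators of the arcs from \<open>A\<close> to \<open>B\<close> and from \<open>C\<close> to \<open>D\<close>, then
  \<open>|F\<^sup>2| = \<langle>M\<^sup>2 f, g\<rangle>\<close>, while \<open>\<langle>M f, g\<rangle>\<close> and \<open>\<langle>\<partial>f, \<partial>g\<rangle>\<close> vanish because the supports do not meet. Hence
  \<open>|F\<^sup>2| = \<langle>R f, g\<rangle>\<close> for \<open>R = M\<^sup>2 - k\<^sub>1 M - (2k\<^sub>1\<^sup>2/k\<^sub>0) \<delta>\<partial>\<close>. On functions that depend only on the type
  of an arc \<open>R\<close> is explicit and yields \<open>6k\<^sub>1\<^sup>2 |E(A,B)| |E(C,D)| / (k\<^sub>0 n)\<close>, which the expander mixing
  lemma evaluates. On the orthogonal complement an eigenvector of \<open>R\<close> either has a nonzero boundary,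
  which is an eigenvector of \<open>\<Delta>\<^sub>0\<^sup>+\<close>, or lies in \<open>Z\<^sub>1\<close> and comes from one of \<open>\<Delta>\<^sub>1\<^sup>+\<close>, so that
  \<open>\<parallel>R\<parallel> \<le> c = 2k\<^sub>1\<^sup>2\<mu>\<^sub>0/k\<^sub>0 + (k\<^sub>1 + \<mu>\<^sub>1)\<mu>\<^sub>1\<close>.

  The last step needs the eigenvalues \<open>3k\<^sub>0/2\<close> and \<open>3k\<^sub>1\<close> to have no eigenvectors beyond the obvious ones. If
  \<open>c \<ge> k\<^sub>1\<^sup>2\<close>, the trivial bound \<open>|F\<^sup>2| \<le> k\<^sub>1\<^sup>2 (|E(A,B)| |E(C,D)|)\<^sup>1\<^sup>/\<^sup>2\<close> suffices. Otherwise
  \<open>\<mu>\<^sub>0 < k\<^sub>0\<close> and \<open>\<mu>\<^sub>1 < k\<^sub>1\<close>, so the graph is connected and its first cohomology vanishes; together with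
  regularity this forces all links to be connected, and a function on arcs that is constant on
  triangles is constant.
\<close>

section \<open>Symmetric operators on finitely supported functions\<close>

definition ip :: "'i set \<Rightarrow> ('i \<Rightarrow> real) \<Rightarrow> ('i \<Rightarrow> real) \<Rightarrow> real" where
  "ip I x y = (\<Sum>i\<in>I. x i * y i)"

text \<open>Vectors indexed by \<open>I\<close> are total functions forced to be 0 off
  \<open>I\<close>, so that equality of functions is equality of vectors and eigenvector equations
  need no restriction to \<open>I\<close>.\<close>

definition supp_in :: "'i set \<Rightarrow> ('i \<Rightarrow> real) set" where
  "supp_in I = {x. \<forall>i. i \<notin> I \<longrightarrow> x i = 0}"

lemma ip_commute: "ip I x y = ip I y x"
  by (simp add: ip_def mult.commute)

lemma ip_add_left: "ip I (\<lambda>i. x i + y i) z = ip I x z + ip I y z"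
  by (simp add: ip_def algebra_simps sum.distrib)

lemma ip_diff_left: "ip I (\<lambda>i. x i - y i) z = ip I x z - ip I y z"
  by (simp add: ip_def algebra_simps sum_subtractf)

lemma ip_scale_left: "ip I (\<lambda>i. a * x i) z = a * ip I x z"
  by (simp add: ip_def algebra_simps sum_distrib_left)

lemma ip_add_right: "ip I z (\<lambda>i. x i + y i) = ip I z x + ip I z y"
  by (simp add: ip_def algebra_simps sum.distrib)

lemma ip_diff_right: "ip I z (\<lambda>i. x i - y i) = ip I z x - ip I z y"
  by (simp add: ip_def algebra_simps sum_subtractf)

lemma ip_scale_right: "ip I z (\<lambda>i. a * x i) = a * ip I z x"
  by (simp add: ip_def algebra_simps sum_distrib_left)

lemmas ip_linear = ip_add_left ip_diff_left ip_scale_left ip_add_right ip_diff_right ip_scale_right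

lemma ip_cong: "(\<And>i. i \<in> I \<Longrightarrow> x i = x' i) \<Longrightarrow> (\<And>i. i \<in> I \<Longrightarrow> y i = y' i) \<Longrightarrow> ip I x y = ip I x' y'"
  by (simp add: ip_def)

lemma ip_self_nonneg: "0 \<le> ip I x x"
  by (simp add: ip_def sum_nonneg)

lemma ip_self_eq_0_iff:
  assumes "finite I" "x \<in> supp_in I"
  shows "ip I x x = 0 \<longleftrightarrow> x = (\<lambda>_. 0)"
  using assms by (auto simp: ip_def supp_in_def sum_nonneg_eq_0_iff fun_eq_iff)

lemma ip_self_pos:
  assumes "finite I" "x \<in> supp_in I" "x \<noteq> (\<lambda>_. 0)"
  shows "0 < ip I x x"
  using assms ip_self_eq_0_iff[of I x] ip_self_nonneg[of I x] by fastforce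

text \<open>Tychonoff in the product topology, with factor \<open>{0}\<close> off \<open>I\<close>.
  The unit sphere of \<open>supp_in I\<close> sits in this box, which makes maximisation over it
  possible.\<close>

lemma compact_supp_in_box:
  "compact {x :: 'i \<Rightarrow> real. \<forall>i. x i \<in> (if i \<in> I then {-1..1} else {0})}"
proof -
  have "compactin (product_topology (\<lambda>i. euclidean) UNIV)
      (PiE UNIV (\<lambda>i. if i \<in> I then {-1..1::real} else {0}))"
    by (subst compactin_PiE) auto
  moreover have "PiE UNIV (\<lambda>i. if i \<in> I then {-1..1::real} else {0})
      = {x. \<forall>i. x i \<in> (if i \<in> I then {-1..1} else {0})}"
    by (auto simp: PiE_def Pi_def)
  ultimately show ?thesis
    by (simp add: euclidean_product_topology)
qed

lemma abs_le_1_if_ip_1: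
  assumes "finite I" "ip I x x = 1" "i \<in> I"
  shows "\<bar>x i\<bar> \<le> 1"
proof -
  have "x i * x i \<le> ip I x x"
    unfolding ip_def using assms by (intro member_le_sum) auto
  then show ?thesis
    using assms(2) by (metis abs_1 abs_le_square_iff one_power2 power2_eq_square)
qed

text \<open>The first-order condition at a maximum: for small \<open>t\<close> a nonzero linear term
  beats the quadratic one. The contradiction comes from \<open>t = a / (1 + |b|)\<close>.\<close>

lemma quadratic_ge_imp_linear_zero:
  fixes a b :: real
  assumes "\<And>t. 2 * t * a \<le> t * t * b"
  shows "a = 0"
proof (rule ccontr)
  assume "a \<noteq> 0"
  define s where "s = 1 + \<bar>b\<bar>"
  have s: "s > 0" "b < s" by (auto simp: s_def)
  have "2 * (a / s) * a \<le> (a / s) * (a / s) * b" by (rule assms)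
  then have "2 * a\<^sup>2 * s \<le> a\<^sup>2 * b"
    using s by (simp add: field_simps power2_eq_square)
  then have "2 * s \<le> b"
    using \<open>a \<noteq> 0\<close> by (simp add: mult.assoc mult.left_commute[of 2])
  then show False using s by linarith
qed

text \<open>A maximiser \<open>x\<close> of the form on the unit sphere of \<open>W\<close> is an
  eigenvector: perturbing \<open>x\<close> along any \<open>y\<close> in \<open>W\<close> shows that
  the residual \<open>S x - \<theta> * x\<close> is orthogonal to \<open>W\<close>, and the residual
  itself lies in \<open>W\<close>.\<close>

lemma rayleigh_max_eigenvector:
  fixes S :: "('i \<Rightarrow> real) \<Rightarrow> 'i \<Rightarrow> real"
  assumes fin: "finite I" and supp: "W \<subseteq> supp_in I" and cl: "closed W"
    and add: "\<And>x y. x \<in> W \<Longrightarrow> y \<in> W \<Longrightarrow> (\<lambda>i. x i + y i) \<in> W"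
    and scale: "\<And>a x. x \<in> W \<Longrightarrow> (\<lambda>i. a * x i) \<in> W"
    and maps: "\<And>x. x \<in> W \<Longrightarrow> S x \<in> W"
    and S_add: "\<And>x y. S (\<lambda>i. x i + y i) = (\<lambda>i. S x i + S y i)"
    and S_scale: "\<And>a x. S (\<lambda>i. a * x i) = (\<lambda>i. a * S x i)"
    and sym: "\<And>x y. x \<in> W \<Longrightarrow> y \<in> W \<Longrightarrow> ip I (S x) y = ip I x (S y)"
    and cont: "\<And>i. continuous_on UNIV (\<lambda>x. S x i)"
    and nz: "w \<in> W" "w \<noteq> (\<lambda>_. 0)"
  obtains x \<theta> where "x \<in> W" "x \<noteq> (\<lambda>_. 0)" "S x = (\<lambda>i. \<theta> * x i)"
    "\<And>y. y \<in> W \<Longrightarrow> ip I (S y) y \<le> \<theta> * ip I y y"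
proof -
  define K where "K = {x \<in> W. ip I x x = 1}"
  have cont_eval: "continuous_on UNIV (\<lambda>x::'i \<Rightarrow> real. x i)" for i
    by (rule continuous_on_product_coordinates)
  have "K = {x. \<forall>i. x i \<in> (if i \<in> I then {-1..1} else {0})} \<inter> (W \<inter> {x. ip I x x = 1})"
    using abs_le_1_if_ip_1[OF fin] supp
    by (fastforce simp: K_def supp_in_def abs_le_iff)
  moreover have "closed {x. ip I x x = 1}"
    unfolding ip_def by (intro closed_Collect_eq continuous_intros cont_eval)
  ultimately have compact: "compact K"
    using cl compact_Int_closed[OF compact_supp_in_box, of "W \<inter> {x. ip I x x = 1}" I] by (simp only: closed_Int)
  have norm: "(\<lambda>i. (1 / sqrt (ip I y y)) * y i) \<in> K" if "y \<in> W" "y \<noteq> (\<lambda>_. 0)" for y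
  proof -
    have "ip I y y > 0" using that supp fin by (intro ip_self_pos) auto
    then have "ip I (\<lambda>i. (1 / sqrt (ip I y y)) * y i) (\<lambda>i. (1 / sqrt (ip I y y)) * y i) = 1"
      unfolding ip_linear by (simp add: field_simps)
    then show ?thesis using scale[OF that(1)] unfolding K_def by blast
  qed
  have "continuous_on K (\<lambda>x. ip I (S x) x)"
    unfolding ip_def
    by (intro continuous_intros continuous_on_subset[OF cont] continuous_on_subset[OF cont_eval]) auto
  moreover have "K \<noteq> {}" using norm[OF nz] by blast
  ultimately obtain x where x: "x \<in> K" and max: "\<And>y. y \<in> K \<Longrightarrow> ip I (S y) y \<le> ip I (S x) x"
    using continuous_attains_sup[OF compact] by blast
  define \<theta> where "\<theta> = ip I (S x) x"
  have xW: "x \<in> W" and x1: "ip I x x = 1" using x by (auto simp: K_def)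
  have bound: "ip I (S y) y \<le> \<theta> * ip I y y" if "y \<in> W" for y
  proof (cases "y = (\<lambda>_. 0)")
    case True
    then show ?thesis by (simp add: ip_def)
  next
    case False
    have pos: "ip I y y > 0" using that False supp fin by (intro ip_self_pos) auto
    have "ip I (S (\<lambda>i. (1 / sqrt (ip I y y)) * y i)) (\<lambda>i. (1 / sqrt (ip I y y)) * y i) \<le> \<theta>"
      unfolding \<theta>_def by (intro max norm that False)
    then have "ip I (S y) y / ip I y y \<le> \<theta>"
      using pos by (simp only: S_scale ip_linear) simp
    then show ?thesis using pos by (simp add: field_simps)
  qed
  define r where "r = (\<lambda>i. S x i + (- \<theta>) * x i)"
  have rW: "r \<in> W" unfolding r_def by (intro add scale maps xW)
  have orth: "ip I (S x) y - \<theta> * ip I x y = 0" if y: "y \<in> W" for y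
  proof (rule quadratic_ge_imp_linear_zero)
    fix t :: real
    let ?z = "\<lambda>i. x i + t * y i"
    have "ip I (S ?z) ?z \<le> \<theta> * ip I ?z ?z" by (intro bound add scale xW y)
    moreover have "ip I x (S y) = ip I (S x) y" using sym[OF xW y] by simp
    \<comment> \<open>Since \<open>x\<close> has norm 1 and attains \<open>\<theta>\<close>, the
      terms free of \<open>t\<close> cancel on both sides.\<close>
    ultimately show "2 * t * (ip I (S x) y - \<theta> * ip I x y) \<le> t * t * (\<theta> * ip I y y - ip I (S y) y)"
      using x1 by (simp add: S_add S_scale ip_linear ip_commute[of I y x] ip_commute[of I "S y" x]
          \<theta>_def[symmetric] algebra_simps)
  qed
  have "ip I r r = 0"
    using orth[OF rW] by (simp add: r_def ip_linear algebra_simps)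
  then have "r = (\<lambda>_. 0)" using ip_self_eq_0_iff[OF fin] rW supp by blast
  then have "S x = (\<lambda>i. \<theta> * x i)" by (simp add: r_def fun_eq_iff)
  moreover have "x \<noteq> (\<lambda>_. 0)" using x1 by (auto simp: ip_def)
  ultimately show thesis using that xW bound by blast
qed

section \<open>Orthogonal complements and bounds for bilinear forms\<close>

definition orth_in :: "'i set \<Rightarrow> ('i \<Rightarrow> real) set \<Rightarrow> ('i \<Rightarrow> real) set" where
  "orth_in I U = {x \<in> supp_in I. \<forall>u\<in>U. ip I x u = 0}"

lemma closed_orth_in: "closed (orth_in I U)"
proof -
  have cont: "continuous_on UNIV (\<lambda>x::'a \<Rightarrow> real. x i)" for i
    by (rule continuous_on_product_coordinates)
  have "closed {x::'a \<Rightarrow> real. i \<notin> I \<longrightarrow> x i = 0}" for i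
    by (cases "i \<in> I") (auto intro!: closed_Collect_eq cont continuous_on_const)
  then have "closed (supp_in I)"
    unfolding supp_in_def by (rule closed_Collect_all)
  moreover have "closed {x. u \<in> U \<longrightarrow> ip I x u = 0}" for u
    unfolding ip_def
    by (cases "u \<in> U") (auto intro!: closed_Collect_eq continuous_intros cont)
  then have "closed {x. \<forall>u\<in>U. ip I x u = 0}"
    unfolding Ball_def by (rule closed_Collect_all)
  moreover have "orth_in I U = supp_in I \<inter> {x. \<forall>u\<in>U. ip I x u = 0}"
    by (auto simp: orth_in_def)
  ultimately show ?thesis by (simp only: closed_Int)
qed

lemma orth_in_add: "x \<in> orth_in I U \<Longrightarrow> y \<in> orth_in I U \<Longrightarrow> (\<lambda>i. x i + y i) \<in> orth_in I U"
  by (auto simp: orth_in_def supp_in_def ip_linear)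

lemma orth_in_scale: "x \<in> orth_in I U \<Longrightarrow> (\<lambda>i. a * x i) \<in> orth_in I U"
  by (auto simp: orth_in_def supp_in_def ip_linear)

lemma orth_in_supp: "orth_in I U \<subseteq> supp_in I"
  by (auto simp: orth_in_def)

text \<open>Taking for \<open>s\<close> and \<open>t\<close> the norms of the opposite vectors
  balances the two squares; flipping the sign of \<open>s\<close> bounds \<open>- p\<close>. For a
  zero vector this choice gives no information, hence the assumption \<open>zero\<close>.\<close>

lemma ip_bound_from_quadratic_form:
  assumes fin: "finite I" and supp: "x \<in> supp_in I" "y \<in> supp_in I"
    and bound: "\<And>s t. 2 * s * t * p \<le> c * (s * s * ip I x x + t * t * ip I y y)"
    and zero: "x = (\<lambda>_. 0) \<or> y = (\<lambda>_. 0) \<Longrightarrow> p = 0"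
  shows "\<bar>p\<bar> \<le> c * (sqrt (ip I x x) * sqrt (ip I y y))"
proof (cases "x = (\<lambda>_. 0) \<or> y = (\<lambda>_. 0)")
  case True
  then show ?thesis using zero by (auto simp: ip_def)
next
  case False
  define X Y where "X = sqrt (ip I x x)" and "Y = sqrt (ip I y y)"
  have pos: "X > 0" "Y > 0" and sq: "ip I x x = X * X" "ip I y y = Y * Y"
    using ip_self_pos[OF fin supp(1)] ip_self_pos[OF fin supp(2)] False
    by (auto simp: X_def Y_def)
  have "2 * (Y * X) * p \<le> 2 * (Y * X) * (c * (X * Y))"
    using bound[of Y X] unfolding sq by (simp add: algebra_simps)
  moreover have "2 * (Y * X) * (- p) \<le> 2 * (Y * X) * (c * (X * Y))"
    using bound[of "- Y" X] unfolding sq by (simp add: algebra_simps)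
  ultimately have "p \<le> c * (X * Y)" "- p \<le> c * (X * Y)"
    using pos by (simp_all only: mult_le_cancel_left_pos mult_pos_pos zero_less_numeral)
  then show ?thesis by (simp add: X_def Y_def abs_le_iff)
qed

text \<open>Gram-Schmidt, by induction on \<open>J\<close>: the new vector \<open>u k\<close> is
  cleared of the span of the old ones before \<open>f\<close> is corrected along it.\<close>

lemma orthogonal_decomposition:
  fixes u :: "'j \<Rightarrow> 'i \<Rightarrow> real"
  assumes "finite I" "finite J"
  shows "\<exists>c. \<forall>j\<in>J. ip I (\<lambda>i. f i - (\<Sum>j\<in>J. c j * u j i)) (u j) = 0"
  using assms(2)
proof (induction J arbitrary: f)
  case empty
  then show ?case by simp
next
  case (insert k J)
  obtain c where c: "\<And>j. j \<in> J \<Longrightarrow> ip I (\<lambda>i. f i - (\<Sum>j\<in>J. c j * u j i)) (u j) = 0"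
    using insert.IH by blast
  obtain d where d: "\<And>j. j \<in> J \<Longrightarrow> ip I (\<lambda>i. u k i - (\<Sum>j\<in>J. d j * u j i)) (u j) = 0"
    using insert.IH by blast
  define f' where "f' = (\<lambda>i. f i - (\<Sum>j\<in>J. c j * u j i))"
  define u' where "u' = (\<lambda>i. u k i - (\<Sum>j\<in>J. d j * u j i))"
  \<comment> \<open>If \<open>u'\<close> vanishes on \<open>I\<close>, the quotient is 0 by the
    convention for division by 0, and there is nothing to correct.\<close>
  define t where "t = ip I f' u' / ip I u' u'"
  define c' where "c' j = (if j = k then t else c j - t * d j)" for j
  have "(\<Sum>j\<in>J. c' j * u j i) = (\<Sum>j\<in>J. c j * u j i) - t * (\<Sum>j\<in>J. d j * u j i)" for i
    using insert.hyps
    by (auto simp: c'_def sum_distrib_left sum_subtractf[symmetric] algebra_simps intro!: sum.cong)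
  then have eq: "(\<lambda>i. f i - (\<Sum>j\<in>insert k J. c' j * u j i)) = (\<lambda>i. f' i - t * u' i)"
    using insert.hyps by (auto simp: f'_def u'_def c'_def algebra_simps fun_eq_iff)
  have J: "ip I (\<lambda>i. f' i - t * u' i) (u j) = 0" if "j \<in> J" for j
    using c[OF that] d[OF that] by (simp add: ip_linear f'_def[symmetric] u'_def[symmetric])
  have u'0: "ip I (\<lambda>i. f' i - t * u' i) u' = 0"
  proof (cases "ip I u' u' = 0")
    case True
    then have "\<And>i. i \<in> I \<Longrightarrow> u' i = 0"
      using assms(1) by (simp add: ip_def sum_nonneg_eq_0_iff)
    then show ?thesis by (simp add: ip_def)
  next
    case False
    then have "t * ip I u' u' = ip I f' u'" by (simp add: t_def)
    then show ?thesis by (simp add: ip_linear)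
  qed
  have "ip I g (\<lambda>i. \<Sum>j\<in>J. d j * u j i) = (\<Sum>j\<in>J. d j * ip I g (u j))" for g
    unfolding ip_def sum_distrib_left sum_distrib_right
    by (subst sum.swap) (simp add: algebra_simps)
  then have "ip I (\<lambda>i. f' i - t * u' i) (\<lambda>i. \<Sum>j\<in>J. d j * u j i) = 0"
    using J by simp
  then have "ip I (\<lambda>i. f' i - t * u' i) (u k) = 0"
    using u'0 unfolding u'_def by (subst (asm) ip_diff_right) simp
  then show ?case using J eq by (intro exI[of _ c']) auto
qed

section \<open>Cyclically oriented tripartite complexes\<close>

text \<open>A regular tripartite complex in cyclic orientation: every edge is one arc raising the
  colour by 1 mod 3, every triangle is three rotated triples in \<open>T\<close>. In- and out-degree
  are both \<open>h\<close>, so the graph has degree \<open>2 * h\<close>.\<close>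

locale cyclic_triangles =
  fixes V :: "'v set" and E :: "('v \<times> 'v) set" and T :: "('v \<times> 'v \<times> 'v) set"
    and col :: "'v \<Rightarrow> nat" and h k :: nat
  assumes fin_V: "finite V" and V_ne: "V \<noteq> {}"
    and E_sub: "E \<subseteq> V \<times> V"
    and col_less: "v \<in> V \<Longrightarrow> col v < 3"
    and col_E: "(u, w) \<in> E \<Longrightarrow> col w = Suc (col u) mod 3"
    and T_E: "(u, w, z) \<in> T \<Longrightarrow> (u, w) \<in> E"
    and T_rot: "(u, w, z) \<in> T \<Longrightarrow> (w, z, u) \<in> T"
    and card_third: "(u, w) \<in> E \<Longrightarrow> card {z. (u, w, z) \<in> T} = k"
    and card_out: "v \<in> V \<Longrightarrow> card {w. (v, w) \<in> E} = h"
    and card_inn: "v \<in> V \<Longrightarrow> card {u. (u, v) \<in> E} = h"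
    and h_pos: "h > 0" and k_pos: "k > 0"
begin

definition third :: "'v \<Rightarrow> 'v \<Rightarrow> 'v set" where "third u w = {z. (u, w, z) \<in> T}"
definition out :: "'v \<Rightarrow> 'v set" where "out v = {w. (v, w) \<in> E}"
definition inn :: "'v \<Rightarrow> 'v set" where "inn v = {u. (u, v) \<in> E}"

text \<open>The arcs of a triangle form a directed cycle, so no signs occur: for skew forms read off
  on arcs, the upper Laplacian is \<open>k\<close> plus this operator.\<close>

definition tri_adj :: "('v \<times> 'v \<Rightarrow> real) \<Rightarrow> 'v \<times> 'v \<Rightarrow> real" where
  "tri_adj x e = (\<Sum>z\<in>third (fst e) (snd e). x (snd e, z) + x (z, fst e))"

definition cob :: "('v \<Rightarrow> real) \<Rightarrow> 'v \<times> 'v \<Rightarrow> real" where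
  "cob g e = (if e \<in> E then g (snd e) - g (fst e) else 0)"

definition bd :: "('v \<times> 'v \<Rightarrow> real) \<Rightarrow> 'v \<Rightarrow> real" where
  "bd x v = (\<Sum>u\<in>inn v. x (u, v)) - (\<Sum>w\<in>out v. x (v, w))"

section \<open>Colours and neighbourhoods\<close>

lemma E_V: "(u, w) \<in> E \<Longrightarrow> u \<in> V" "(u, w) \<in> E \<Longrightarrow> w \<in> V"
  using E_sub by auto

lemma T_V: assumes "(u, w, z) \<in> T" shows "u \<in> V" "w \<in> V" "z \<in> V"
  using assms T_E T_rot E_V by blast+

lemma T_edges: assumes "(u, w, z) \<in> T" shows "(u, w) \<in> E" "(w, z) \<in> E" "(z, u) \<in> E"
  using assms T_E T_rot by blast+

lemma fin_E: "finite E"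
  using E_sub fin_V finite_subset by blast

lemma fin_T: "finite T"
proof (rule finite_subset)
  show "T \<subseteq> V \<times> V \<times> V" using T_V by auto
qed (use fin_V in auto)

lemma fin_nbrs [simp, intro]: "finite (third u w)" "finite (out v)" "finite (inn v)"
  using fin_V T_V E_V by (auto simp: third_def out_def inn_def intro: finite_subset[OF _ fin_V])

lemma card_nbrs: "(u, w) \<in> E \<Longrightarrow> card (third u w) = k" "v \<in> V \<Longrightarrow> card (out v) = h"
  "v \<in> V \<Longrightarrow> card (inn v) = h"
  using card_third card_out card_inn by (auto simp: third_def out_def inn_def)

lemma nbrs_empty: "(u, w) \<notin> E \<Longrightarrow> third u w = {}" "v \<notin> V \<Longrightarrow> out v = {}" "v \<notin> V \<Longrightarrow> inn v = {}"
  using T_E E_V by (auto simp: third_def out_def inn_def)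

lemma col_E_cases:
  assumes "(u, w) \<in> E"
  shows "col u = 0 \<and> col w = 1 \<or> col u = 1 \<and> col w = 2 \<or> col u = 2 \<and> col w = 0"
proof -
  have "col u < 3" "col w = Suc (col u) mod 3" using assms col_less col_E E_V by auto
  then have "col u = 0 \<or> col u = 1 \<or> col u = 2" "col w = Suc (col u) mod 3" by linarith+
  then show ?thesis by auto
qed

lemma col_E_iff:
  assumes "(u, w) \<in> E" "i < 3"
  shows "col w = Suc i mod 3 \<longleftrightarrow> col u = i"
proof -
  have "i = 0 \<or> i = 1 \<or> i = 2" using assms by linarith
  then show ?thesis using col_E_cases[OF assms(1)] by auto
qed

lemma col_T_cases:
  assumes "(u, w, z) \<in> T"
  shows "col u = 0 \<and> col w = 1 \<and> col z = 2 \<or> col u = 1 \<and> col w = 2 \<and> col z = 0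
    \<or> col u = 2 \<and> col w = 0 \<and> col z = 1"
  using col_E_cases[OF T_edges(1)[OF assms]] col_E_cases[OF T_edges(2)[OF assms]] by auto

lemma E_asym: "(u, w) \<in> E \<Longrightarrow> (w, u) \<notin> E"
  using col_E_cases[of u w] col_E_cases[of w u] by auto

section \<open>Double counting over arcs and triangles\<close>

lemma sum_E_out: "(\<Sum>(u, w)\<in>E. F u w) = (\<Sum>u\<in>V. \<Sum>w\<in>out u. F u w)"
proof -
  have "E = Sigma V out" using E_V by (auto simp: out_def)
  then show ?thesis using fin_V by (simp add: sum.Sigma)
qed

lemma sum_E_inn: "(\<Sum>(u, w)\<in>E. F u w) = (\<Sum>w\<in>V. \<Sum>u\<in>inn w. F u w)"
proof -
  have "(\<Sum>(u, w)\<in>E. F u w) = (\<Sum>(w, u)\<in>Sigma V inn. F u w)"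
    by (rule sum.reindex_bij_witness[of _ "\<lambda>(w, u). (u, w)" "\<lambda>(u, w). (w, u)"])
      (use E_V in \<open>auto simp: inn_def\<close>)
  then show ?thesis using fin_V by (simp add: sum.Sigma)
qed

lemma sum_T: "(\<Sum>(u, w, z)\<in>T. F u w z) = (\<Sum>(u, w)\<in>E. \<Sum>z\<in>third u w. F u w z)"
proof -
  have "(\<Sum>(u, w, z)\<in>T. F u w z) = (\<Sum>(e, z)\<in>Sigma E (\<lambda>e. third (fst e) (snd e)). F (fst e) (snd e) z)"
    by (rule sum.reindex_bij_witness[of _ "\<lambda>((u, w), z). (u, w, z)" "\<lambda>(u, w, z). ((u, w), z)"])
      (use T_E in \<open>auto simp: third_def\<close>)
  also have "\<dots> = (\<Sum>e\<in>E. \<Sum>z\<in>third (fst e) (snd e). F (fst e) (snd e) z)"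
    using fin_E by (simp add: sum.Sigma)
  finally show ?thesis by (simp add: case_prod_beta')
qed

lemma sum_T_rot: "(\<Sum>(u, w, z)\<in>T. F u w z) = (\<Sum>(u, w, z)\<in>T. F w z u)"
  by (rule sum.reindex_bij_witness[of _ "\<lambda>(u, w, z). (w, z, u)" "\<lambda>(u, w, z). (z, u, w)"])
    (use T_rot in auto)

lemma ip_E: "ip E x y = (\<Sum>(u, w)\<in>E. x (u, w) * y (u, w))"
  by (simp add: ip_def case_prod_beta')

section \<open>Operators on arcs and vertices and their adjoints\<close>

lemma tri_adj_outside: "e \<notin> E \<Longrightarrow> tri_adj x e = 0"
  by (cases e) (simp add: tri_adj_def nbrs_empty)

lemma tri_adj_supp: "tri_adj x \<in> supp_in E"
  by (simp add: supp_in_def tri_adj_outside)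

lemma cob_supp: "cob g \<in> supp_in E"
  by (auto simp: cob_def supp_in_def)

lemma bd_supp: "bd x \<in> supp_in V"
  by (auto simp: bd_def supp_in_def nbrs_empty)

lemma tri_adj_add: "tri_adj (\<lambda>e. x e + y e) = (\<lambda>e. tri_adj x e + tri_adj y e)"
  by (rule ext) (simp add: tri_adj_def sum.distrib algebra_simps)

lemma tri_adj_scale: "tri_adj (\<lambda>e. a * x e) = (\<lambda>e. a * tri_adj x e)"
  by (rule ext) (simp add: tri_adj_def sum_distrib_left algebra_simps)

lemma tri_adj_diff: "tri_adj (\<lambda>e. x e - y e) = (\<lambda>e. tri_adj x e - tri_adj y e)"
  using tri_adj_add[of x "\<lambda>e. - 1 * y e"] tri_adj_scale[of "- 1" y] by simp

lemma bd_add: "bd (\<lambda>e. x e + y e) = (\<lambda>e. bd x e + bd y e)"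
  by (rule ext) (simp add: bd_def sum.distrib algebra_simps)

lemma bd_scale: "bd (\<lambda>e. a * x e) = (\<lambda>e. a * bd x e)"
  by (rule ext) (simp add: bd_def sum_distrib_left algebra_simps)

lemma bd_diff: "bd (\<lambda>e. x e - y e) = (\<lambda>e. bd x e - bd y e)"
  by (rule ext) (simp add: bd_def sum_subtractf algebra_simps)

lemma cob_add: "cob (\<lambda>v. x v + y v) = (\<lambda>e. cob x e + cob y e)"
  by (rule ext) (simp add: cob_def)

lemma cob_scale: "cob (\<lambda>v. a * x v) = (\<lambda>e. a * cob x e)"
  by (rule ext) (simp add: cob_def algebra_simps)

text \<open>Rotating the triangles in the second half of the sum turns it into the mirror image of
  the first half, which makes the symmetry of \<open>tri_adj\<close> visible.\<close>

lemma ip_tri_adj_left: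
  "ip E (tri_adj x) y = (\<Sum>(u, w, z)\<in>T. x (w, z) * y (u, w)) + (\<Sum>(u, w, z)\<in>T. x (u, w) * y (w, z))"
proof -
  have "ip E (tri_adj x) y = (\<Sum>(u, w)\<in>E. \<Sum>z\<in>third u w. (x (w, z) + x (z, u)) * y (u, w))"
    by (simp add: ip_E tri_adj_def sum_distrib_right)
  also have "\<dots> = (\<Sum>(u, w, z)\<in>T. (x (w, z) + x (z, u)) * y (u, w))"
    by (rule sum_T[symmetric])
  also have "\<dots> = (\<Sum>(u, w, z)\<in>T. x (w, z) * y (u, w)) + (\<Sum>(u, w, z)\<in>T. x (z, u) * y (u, w))"
    by (simp add: case_prod_beta' sum.distrib algebra_simps)
  also have "(\<Sum>(u, w, z)\<in>T. x (z, u) * y (u, w)) = (\<Sum>(u, w, z)\<in>T. x (u, w) * y (w, z))"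
    using sum_T_rot[of "\<lambda>u w z. x (z, u) * y (u, w)"] .
  finally show ?thesis .
qed

lemma tri_adj_sym: "ip E (tri_adj x) y = ip E x (tri_adj y)"
  unfolding ip_commute[of E x] ip_tri_adj_left by (simp add: mult.commute)

lemma ip_cob: "ip E (cob g) x = ip V g (bd x)"
proof -
  have "ip E (cob g) x = (\<Sum>(u, w)\<in>E. g w * x (u, w)) - (\<Sum>(u, w)\<in>E. g u * x (u, w))"
    by (auto simp: ip_E cob_def sum_subtractf[symmetric] algebra_simps intro!: sum.cong)
  also have "\<dots> = ip V g (bd x)"
    unfolding sum_E_inn[of "\<lambda>u w. g w * x (u, w)"] sum_E_out[of "\<lambda>u w. g u * x (u, w)"]
    by (simp add: ip_def bd_def sum_distrib_left sum_subtractf[symmetric] algebra_simps)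
  finally show ?thesis .
qed

text \<open>Differences around a triangle add up to zero, so each third vertex contributes minus the
  value at the given arc.\<close>

lemma tri_adj_cob: "tri_adj (cob g) = (\<lambda>e. - real k * cob g e)"
proof
  fix e
  show "tri_adj (cob g) e = - real k * cob g e"
  proof (cases "e \<in> E")
    case True
    obtain u w where e: "e = (u, w)" by (cases e)
    have "tri_adj (cob g) e = (\<Sum>z\<in>third u w. g u - g w)"
      unfolding tri_adj_def e
      by (rule sum.cong) (auto simp: cob_def third_def dest: T_edges)
    then show ?thesis using True by (simp add: e card_nbrs cob_def algebra_simps)
  next
    case False
    then show ?thesis by (simp add: cob_def tri_adj_outside)
  qed
qed

lemma bd_eq_ip:
  assumes "v \<in> V"
  shows "bd x v = ip E (cob (\<lambda>u. if u = v then 1 else 0)) x"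
  unfolding ip_cob unfolding ip_def
  using assms fin_V by (simp add: if_distrib[of "\<lambda>t. t * _"] cong: if_cong)

text \<open>The adjoint of \<open>tri_adj_cob\<close>, obtained by pairing with coboundaries of
  point masses.\<close>

lemma bd_tri_adj: "bd (tri_adj x) = (\<lambda>v. - real k * bd x v)"
proof
  fix v
  show "bd (tri_adj x) v = - real k * bd x v"
  proof (cases "v \<in> V")
    case True
    then show ?thesis
      by (simp only: bd_eq_ip tri_adj_sym[symmetric] tri_adj_cob ip_scale_left)
  next
    case False
    then show ?thesis using bd_supp by (auto simp: supp_in_def)
  qed
qed

text \<open>The type of an arc is the colour of its tail. The span of the three indicators is
  invariant under \<open>tri_adj\<close> and \<open>cob\<close> after \<open>bd\<close>, and carries
  the obvious eigenvectors for the exceptional eigenvalues.\<close>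

definition type_ind :: "nat \<Rightarrow> 'v \<times> 'v \<Rightarrow> real" where
  "type_ind i e = (if e \<in> E \<and> col (fst e) = i then 1 else 0)"

definition one_E :: "'v \<times> 'v \<Rightarrow> real" where
  "one_E e = (if e \<in> E then 1 else 0)"

definition block_ind :: "nat \<Rightarrow> 'v \<Rightarrow> real" where
  "block_ind i v = (if v \<in> V \<and> col v = i then 1 else 0)"

lemma one_E_eq: "one_E = (\<lambda>e. type_ind 0 e + type_ind 1 e + type_ind 2 e)"
  using col_E_cases by (fastforce simp: one_E_def type_ind_def fun_eq_iff)

text \<open>A triangle has exactly one arc of each type, so the other two arcs contribute 1 exactly
  when the given arc is not of type \<open>i\<close>.\<close>

lemma tri_adj_ty:
  assumes "i < 3"
  shows "tri_adj (type_ind i) = (\<lambda>e. k * (one_E e - type_ind i e))"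
proof
  fix e
  show "tri_adj (type_ind i) e = k * (one_E e - type_ind i e)"
  proof (cases "e \<in> E")
    case True
    obtain u w where e: "e = (u, w)" by (cases e)
    have i: "i = 0 \<or> i = 1 \<or> i = 2" using assms by linarith
    have "type_ind i (w, z) + type_ind i (z, u) = one_E e - type_ind i e" if "z \<in> third u w" for z
    proof -
      have t: "(u, w, z) \<in> T" using that by (simp add: third_def)
      show ?thesis
        using i col_T_cases[OF t] T_edges[OF t] by (auto simp: type_ind_def one_E_def e)
    qed
    then have "tri_adj (type_ind i) e = (\<Sum>z\<in>third u w. one_E e - type_ind i e)"
      unfolding tri_adj_def e by (intro sum.cong) auto
    then show ?thesis using True by (simp add: e card_nbrs)
  next
    case False
    then show ?thesis by (simp add: tri_adj_outside one_E_def type_ind_def)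
  qed
qed

lemma tri_adj_one_E: "tri_adj one_E = (\<lambda>e. 2 * k * one_E e)"
proof -
  have "tri_adj one_E = (\<lambda>e. tri_adj (type_ind 0) e + tri_adj (type_ind 1) e + tri_adj (type_ind 2) e)"
    by (simp only: one_E_eq tri_adj_add)
  also have "\<dots> = (\<lambda>e. 2 * k * one_E e)"
    by (simp add: tri_adj_ty one_E_eq algebra_simps)
  finally show ?thesis .
qed

text \<open>The boundary of a type function is \<open>h\<close> times a difference of two block
  indicators; its coboundary depends on the type again.\<close>

lemma cob_bd_ty:
  assumes "i < 3"
  shows "cob (bd (type_ind i)) = (\<lambda>e. h * (3 * type_ind i e - one_E e))"
proof
  fix e :: "'v \<times> 'v"
  have i: "i = 0 \<or> i = 1 \<or> i = 2" using assms by linarith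
  have bd: "bd (type_ind i) v = real h * ((if col v = Suc i mod 3 then 1 else 0) - (if col v = i then 1 else 0))"
    if "v \<in> V" for v
  proof -
    have "(\<Sum>u\<in>inn v. type_ind i (u, v)) = (\<Sum>u\<in>inn v. if col v = Suc i mod 3 then 1 else 0)"
      using i by (intro sum.cong) (auto simp: inn_def type_ind_def dest: col_E_cases)
    moreover have "(\<Sum>w\<in>out v. type_ind i (v, w)) = (\<Sum>w\<in>out v. if col v = i then 1 else 0)"
      by (intro sum.cong) (auto simp: out_def type_ind_def)
    ultimately show ?thesis using that by (simp add: bd_def card_nbrs algebra_simps)
  qed
  show "cob (bd (type_ind i)) e = h * (3 * type_ind i e - one_E e)"
  proof (cases "e \<in> E")
    case True
    obtain u w where e: "e = (u, w)" by (cases e)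
    show ?thesis
      using True i col_E_cases[of u w] E_V[of u w]
      by (auto simp: cob_def e bd type_ind_def one_E_def)
  next
    case False
    then show ?thesis by (auto simp: cob_def type_ind_def one_E_def)
  qed
qed

text \<open>On the image of \<open>cob\<close>, where \<open>tri_adj\<close> is \<open>-k\<close>, the last summand replaces the eigenvalue
  \<open>2 k\<^sup>2\<close> of the first two by \<open>2 k\<^sup>2 (1 - \<lambda>/(2 h))\<close>, which is small for \<open>\<lambda>\<close> near the degree \<open>2 h\<close>.\<close>

definition walk_op :: "('v \<times> 'v \<Rightarrow> real) \<Rightarrow> 'v \<times> 'v \<Rightarrow> real" where
  "walk_op x e = tri_adj (tri_adj x) e - k * tri_adj x e - k\<^sup>2 / h * cob (bd x) e"

lemma walk_op_supp: "walk_op x \<in> supp_in E"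
  using tri_adj_supp[of x] tri_adj_supp[of "tri_adj x"] cob_supp[of "bd x"]
  by (simp add: walk_op_def supp_in_def)

lemma walk_op_add: "walk_op (\<lambda>e. x e + y e) = (\<lambda>e. walk_op x e + walk_op y e)"
  by (rule ext) (simp add: walk_op_def tri_adj_add bd_add cob_add algebra_simps)

lemma walk_op_scale: "walk_op (\<lambda>e. a * x e) = (\<lambda>e. a * walk_op x e)"
  by (rule ext) (simp add: walk_op_def tri_adj_scale bd_scale cob_scale algebra_simps)

lemma ip_walk_op:
  "ip E (walk_op x) y = ip E (tri_adj x) (tri_adj y) - k * ip E (tri_adj x) y - k\<^sup>2 / h * ip V (bd x) (bd y)"
  unfolding walk_op_def by (simp add: ip_linear tri_adj_sym[of "tri_adj x"] ip_cob del: times_divide_eq_left)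

lemma walk_op_sym: "ip E (walk_op x) y = ip E x (walk_op y)"
proof -
  have "ip E (walk_op x) y = ip E (walk_op y) x"
    by (simp add: ip_walk_op ip_commute[of E "tri_adj x" "tri_adj y"] ip_commute[of V "bd x"]
        tri_adj_sym[of x y] ip_commute[of E x])
  then show ?thesis by (simp add: ip_commute[of E x])
qed

text \<open>Paired with a different type function this gives \<open>k^2\<close> times the number of
  arcs of that type, the source of the main term.\<close>

lemma walk_op_ty:
  assumes "i < 3"
  shows "walk_op (type_ind i) = (\<lambda>e. k\<^sup>2 * (one_E e - type_ind i e))"
proof
  fix e
  have "tri_adj (tri_adj (type_ind i)) e = k * (2 * k * one_E e - k * (one_E e - type_ind i e))"
    by (simp add: tri_adj_ty[OF assms] tri_adj_scale tri_adj_diff tri_adj_one_E)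
  then show "walk_op (type_ind i) e = k\<^sup>2 * (one_E e - type_ind i e)"
    using h_pos by (simp add: walk_op_def tri_adj_ty[OF assms] cob_bd_ty[OF assms] field_simps power2_eq_square)
qed

text \<open>\<open>bd\<close> intertwines \<open>walk_op\<close> with an affine function of the
  graph Laplacian, so a nonzero boundary of an eigenvector is a Laplacian eigenvector.\<close>

lemma bd_walk_op: "bd (walk_op x) v = 2 * k\<^sup>2 * bd x v - k\<^sup>2 / h * bd (cob (bd x)) v"
proof -
  have "walk_op x = (\<lambda>e. tri_adj (tri_adj x) e - k * tri_adj x e - k\<^sup>2 / h * cob (bd x) e)"
    by (simp add: walk_op_def fun_eq_iff)
  then show ?thesis
    by (simp add: bd_diff bd_scale bd_tri_adj power2_eq_square del: times_divide_eq_left)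
qed

end

context cyclic_triangles begin

section \<open>Expander mixing\<close>

definition block :: "nat \<Rightarrow> 'v set" where "block i = {v \<in> V. col v = i}"

lemma fin_block [simp, intro]: "finite (block i)"
  using fin_V by (simp add: block_def)

lemma sum_block: "(\<Sum>v\<in>V. if col v = i then a else 0) = a * real (card (block i))"
  using fin_V by (simp add: block_def sum.If_cases Int_def)

lemma ip_ty_self: "ip E (type_ind i) (type_ind i) = h * card (block i)"
proof -
  have "ip E (type_ind i) (type_ind i) = (\<Sum>(u, w)\<in>E. if col u = i then 1 else 0)"
    by (auto simp: ip_E type_ind_def intro!: sum.cong)
  also have "\<dots> = (\<Sum>u\<in>V. if col u = i then real h else 0)"
    unfolding sum_E_out by (auto simp: card_nbrs intro!: sum.cong)
  finally show ?thesis by (simp add: sum_block)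
qed

text \<open>The arcs of type \<open>i\<close> are counted once by their tails and once by their
  heads.\<close>

lemma card_block_Suc:
  assumes "i < 3"
  shows "card (block (Suc i mod 3)) = card (block i)"
proof -
  have "ip E (type_ind i) (type_ind i) = (\<Sum>(u, w)\<in>E. if col w = Suc i mod 3 then 1 else 0)"
    using assms by (auto simp: ip_E type_ind_def col_E_iff intro!: sum.cong)
  also have "\<dots> = (\<Sum>w\<in>V. if col w = Suc i mod 3 then real h else 0)"
    unfolding sum_E_inn by (auto simp: card_nbrs intro!: sum.cong)
  finally have "real h * real (card (block i)) = real h * real (card (block (Suc i mod 3)))"
    by (simp only: sum_block ip_ty_self of_nat_mult)
  then show ?thesis using h_pos by simp
qed

lemma card_block:
  assumes "i < 3"
  shows "real (card (block i)) = card V / 3"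
proof -
  have "V = block 0 \<union> (block 1 \<union> block 2)"
    using col_less by (fastforce simp: block_def)
  moreover have "block 0 \<inter> (block 1 \<union> block 2) = {}" "block 1 \<inter> block 2 = {}"
    by (auto simp: block_def)
  ultimately have "card V = card (block 0) + (card (block 1) + card (block 2))"
    by (metis card_Un_disjoint fin_block finite_UnI)
  moreover have "card (block 1) = card (block 0)" "card (block 2) = card (block 1)"
    using card_block_Suc[of 0] card_block_Suc[of 1] by (simp_all add: numeral_2_eq_2)
  moreover have "i = 0 \<or> i = 1 \<or> i = 2" using assms by linarith
  ultimately show ?thesis by auto
qed

lemma card_block_pos: "i < 3 \<Longrightarrow> card (block i) > 0"
  using card_block[of i] fin_V V_ne by (cases "card (block i) = 0") auto

section \<open>The adjacency operator of the graph\<close>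

definition vadj :: "('v \<Rightarrow> real) \<Rightarrow> 'v \<Rightarrow> real" where
  "vadj g v = (\<Sum>u\<in>inn v. g u) + (\<Sum>w\<in>out v. g w)"

lemma bd_cob:
  fixes g :: "'v \<Rightarrow> real"
  assumes "v \<in> V"
  shows "bd (cob g) v = 2 * real h * g v - vadj g v"
proof -
  have "(\<Sum>u\<in>inn v. cob g (u, v)) = (\<Sum>u\<in>inn v. g v - g u)"
    by (intro sum.cong) (auto simp: cob_def inn_def)
  moreover have "(\<Sum>w\<in>out v. cob g (v, w)) = (\<Sum>w\<in>out v. g w - g v)"
    by (intro sum.cong) (auto simp: cob_def out_def)
  ultimately show ?thesis
    using assms by (simp add: bd_def vadj_def sum_subtractf card_nbrs)
qed

lemma vadj_supp: "vadj g \<in> supp_in V"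
  by (simp add: vadj_def supp_in_def nbrs_empty)

lemma vadj_add: "vadj (\<lambda>v. f v + g v) = (\<lambda>v. vadj f v + vadj g v)"
  by (rule ext) (simp add: vadj_def sum.distrib)

lemma vadj_scale: "vadj (\<lambda>v. a * f v) = (\<lambda>v. a * vadj f v)"
  by (rule ext) (simp add: vadj_def sum_distrib_left algebra_simps)

lemma ip_vadj: "ip V (vadj f) g = (\<Sum>(u, w)\<in>E. f u * g w + f w * g u)"
proof -
  have "(\<Sum>(u, w)\<in>E. f u * g w + f w * g u)
      = (\<Sum>(u, w)\<in>E. f u * g w) + (\<Sum>(u, w)\<in>E. f w * g u)"
    by (simp add: case_prod_beta' sum.distrib)
  also have "\<dots> = ip V (vadj f) g"
    unfolding sum_E_inn[of "\<lambda>u w. f u * g w"] sum_E_out[of "\<lambda>u w. f w * g u"]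
    by (simp add: ip_def vadj_def sum_distrib_right sum.distrib distrib_right)
  finally show ?thesis by simp
qed

lemma vadj_sym: "ip V (vadj f) g = ip V f (vadj g)"
  unfolding ip_commute[of V f] ip_vadj by (simp add: algebra_simps)

text \<open>A vertex of colour \<open>i\<close> has no neighbour of that colour; any other vertex
  has exactly \<open>h\<close>, all incoming or all outgoing.\<close>

lemma ip_vadj_bl:
  assumes "i < 3"
  shows "ip V (vadj f) (block_ind i) = h * ((\<Sum>v\<in>V. f v) - ip V f (block_ind i))"
proof -
  have i: "i = 0 \<or> i = 1 \<or> i = 2" using assms by linarith
  have "vadj (block_ind i) v = h * (1 - block_ind i v)" if "v \<in> V" for v
  proof -
    define p q where "p = (if col v = Suc i mod 3 then 1 else 0 :: real)"
      and "q = (if i = Suc (col v) mod 3 then 1 else 0 :: real)"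
    have "(\<Sum>u\<in>inn v. block_ind i u) = (\<Sum>u\<in>inn v. p)"
      using assms E_V by (intro sum.cong) (auto simp: inn_def block_ind_def col_E_iff p_def)
    moreover have "(\<Sum>w\<in>out v. block_ind i w) = (\<Sum>w\<in>out v. q)"
      using E_V by (intro sum.cong) (auto simp: out_def block_ind_def col_E q_def)
    moreover have "p + q = 1 - block_ind i v"
    proof -
      have "col v = 0 \<or> col v = 1 \<or> col v = 2" using col_less[OF that] by linarith
      then show ?thesis using that i by (elim disjE) (simp_all add: block_ind_def p_def q_def)
    qed
    ultimately show ?thesis using that
      by (simp add: vadj_def card_nbrs flip: distrib_left)
  qed
  then have "ip V (vadj f) (block_ind i) = ip V f (\<lambda>v. h * (1 - block_ind i v))"
    unfolding vadj_sym by (intro ip_cong) auto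
  then show ?thesis
    by (simp add: ip_def sum_distrib_left sum_subtractf[symmetric] algebra_simps)
qed

section \<open>Continuity of the operators in the product topology\<close>

lemma cont_tri_adj:
  assumes "\<And>e. continuous_on UNIV (\<lambda>x. y x e)"
  shows "continuous_on UNIV (\<lambda>x. tri_adj (y x) e)"
  unfolding tri_adj_def by (intro continuous_intros assms)

lemma cont_bd:
  assumes "\<And>e. continuous_on UNIV (\<lambda>x. y x e)"
  shows "continuous_on UNIV (\<lambda>x. bd (y x) v)"
  unfolding bd_def by (intro continuous_intros assms)

lemma cont_cob:
  assumes "\<And>v. continuous_on UNIV (\<lambda>x. y x v)"
  shows "continuous_on UNIV (\<lambda>x. cob (y x) e)"
  unfolding cob_def by (cases "e \<in> E") (auto intro!: continuous_intros assms)

lemma cont_walk_op: "continuous_on UNIV (\<lambda>x. walk_op x e)"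
  unfolding walk_op_def
  by (intro continuous_intros cont_tri_adj cont_cob cont_bd continuous_on_product_coordinates)

lemma cont_vadj: "continuous_on UNIV (\<lambda>x. vadj x v)"
  unfolding vadj_def by (intro continuous_intros continuous_on_product_coordinates)

text \<open>Splitting off the functions of the colour, respectively of the arc type, removes the
  obvious exceptional eigenvectors and leaves subspaces that the operators preserve.\<close>

definition V0 :: "('v \<Rightarrow> real) set" where "V0 = orth_in V (block_ind ` {..<3})"
definition E0 :: "('v \<times> 'v \<Rightarrow> real) set" where "E0 = orth_in E (type_ind ` {..<3})"

lemma sum_V_blocks: "(\<Sum>v\<in>V. g v) = ip V g (block_ind 0) + ip V g (block_ind 1) + ip V g (block_ind 2)"
proof -
  have "g v = g v * block_ind 0 v + g v * block_ind 1 v + g v * block_ind 2 v" if "v \<in> V" for v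
  proof -
    have "col v = 0 \<or> col v = 1 \<or> col v = 2" using col_less[OF that] by linarith
    then show ?thesis using that by (auto simp: block_ind_def)
  qed
  then show ?thesis by (simp add: ip_def sum.distrib[symmetric])
qed

lemma V0_sum: "g \<in> V0 \<Longrightarrow> (\<Sum>v\<in>V. g v) = 0"
  unfolding sum_V_blocks by (simp add: V0_def orth_in_def)

lemma V0_supp: "g \<in> V0 \<Longrightarrow> g \<in> supp_in V" and E0_supp: "x \<in> E0 \<Longrightarrow> x \<in> supp_in E"
  by (auto simp: V0_def E0_def orth_in_def)

lemma V0_vadj: "g \<in> V0 \<Longrightarrow> vadj g \<in> V0"
  using vadj_supp V0_sum[of g] by (auto simp: V0_def orth_in_def ip_vadj_bl)

lemma ip_one_E: "x \<in> E0 \<Longrightarrow> ip E x one_E = 0"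
  by (simp add: one_E_eq E0_def orth_in_def ip_linear)

lemma E0_tri_adj: "x \<in> E0 \<Longrightarrow> tri_adj x \<in> E0"
  using tri_adj_supp ip_one_E[of x]
  by (auto simp: E0_def orth_in_def tri_adj_sym tri_adj_ty ip_linear)

lemma E0_walk_op: "x \<in> E0 \<Longrightarrow> walk_op x \<in> E0"
  using walk_op_supp ip_one_E[of x]
  by (auto simp: E0_def orth_in_def walk_op_sym walk_op_ty ip_linear)

lemma E0_add: "x \<in> E0 \<Longrightarrow> y \<in> E0 \<Longrightarrow> (\<lambda>e. x e + y e) \<in> E0"
  and E0_scale: "x \<in> E0 \<Longrightarrow> (\<lambda>e. a * x e) \<in> E0"
  by (simp_all add: E0_def orth_in_add orth_in_scale)

lemma E0_diff: "x \<in> E0 \<Longrightarrow> y \<in> E0 \<Longrightarrow> (\<lambda>e. x e - y e) \<in> E0"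
  using E0_add[of x "\<lambda>e. - 1 * y e"] E0_scale[of y "- 1"] by simp

lemma cob_bl:
  assumes "i < 3"
  shows "cob (block_ind i) = (\<lambda>e. type_ind (Suc (Suc i) mod 3) e - type_ind i e)"
proof
  fix e :: "'v \<times> 'v"
  obtain u w where e: "e = (u, w)" by (cases e)
  have i: "i = 0 \<or> i = 1 \<or> i = 2" using assms by linarith
  show "cob (block_ind i) e = type_ind (Suc (Suc i) mod 3) e - type_ind i e"
    using i col_E_cases[of u w] E_V[of u w] by (auto simp: cob_def block_ind_def type_ind_def e)
qed

text \<open>By adjointness, because the coboundary of a block indicator is a difference of type
  functions.\<close>

lemma E0_bd: "x \<in> E0 \<Longrightarrow> bd x \<in> V0"
proof -
  assume x: "x \<in> E0"
  have "ip V (bd x) (block_ind i) = 0" if "i < 3" for i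
  proof -
    have "ip V (bd x) (block_ind i) = ip E x (cob (block_ind i))"
      by (metis ip_cob ip_commute)
    then show ?thesis using x that by (simp add: cob_bl ip_linear E0_def orth_in_def)
  qed
  then show "bd x \<in> V0" using bd_supp by (auto simp: V0_def orth_in_def)
qed

end

text \<open>Here \<open>2 * h\<close> and \<open>3 * h\<close> stand for the degree and one and a
  half times the degree, and \<open>m\<close> is an eigenvalue of the upper edge Laplacian lowered
  by \<open>k\<close>.\<close>

locale spectral_triangles = cyclic_triangles V E T col h k
  for V :: "'v set" and E T col h k +
  fixes mu0 mu1 :: real
  assumes mu0_nonneg: "mu0 \<ge> 0" and mu1_nonneg: "mu1 \<ge> 0"
    and spec0: "g \<in> supp_in V \<Longrightarrow> g \<noteq> (\<lambda>_. 0) \<Longrightarrow> (\<Sum>v\<in>V. g v) = 0 \<Longrightarrow>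
      bd (cob g) = (\<lambda>v. ev * g v) \<Longrightarrow> \<bar>ev - 2 * real h\<bar> \<le> mu0 \<or> ev = 3 * real h"
    and spec1: "x \<in> supp_in E \<Longrightarrow> x \<noteq> (\<lambda>_. 0) \<Longrightarrow> bd x = (\<lambda>_. 0) \<Longrightarrow>
      tri_adj x = (\<lambda>e. m * x e) \<Longrightarrow> \<bar>m\<bar> \<le> mu1 \<or> \<bar>m - real k\<bar> \<le> mu1 \<or> m = 2 * real k"
begin

lemma bd_cob_eigen:
  fixes g :: "'v \<Rightarrow> real" and \<theta> :: real
  assumes "g \<in> supp_in V" "vadj g = (\<lambda>v. \<theta> * g v)"
  shows "bd (cob g) = (\<lambda>v. (2 * real h - \<theta>) * g v)"
proof
  fix v
  show "bd (cob g) v = (2 * real h - \<theta>) * g v"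
    using assms bd_supp[of "cob g"] bd_cob[of v g]
    by (cases "v \<in> V") (simp_all add: supp_in_def algebra_simps)
qed

text \<open>The top adjacency eigenvalue on \<open>V0\<close> is \<open>2 * h\<close> minus a
  Laplacian eigenvalue; the exceptional \<open>3 * h\<close> gives the negative value
  \<open>- h\<close>, which respects the upper bound.\<close>

lemma vadj_form_le:
  assumes "g \<in> V0"
  shows "ip V (vadj g) g \<le> mu0 * ip V g g"
proof (cases "g = (\<lambda>_. 0)")
  case True
  then show ?thesis by (simp add: ip_def)
next
  case False
  obtain x \<theta> where x: "x \<in> V0" "x \<noteq> (\<lambda>_. 0)" "vadj x = (\<lambda>i. \<theta> * x i)"
    and le: "\<And>y. y \<in> V0 \<Longrightarrow> ip V (vadj y) y \<le> \<theta> * ip V y y"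
    by (rule rayleigh_max_eigenvector[OF fin_V _ _ _ _ _ vadj_add vadj_scale vadj_sym cont_vadj
          assms False])
      (auto simp: V0_def orth_in_add orth_in_scale closed_orth_in V0_vadj[unfolded V0_def]
        intro: subsetD[OF orth_in_supp])
  have "\<bar>(2 * real h - \<theta>) - 2 * real h\<bar> \<le> mu0 \<or> 2 * real h - \<theta> = 3 * real h"
    using x by (intro spec0[of x] bd_cob_eigen V0_supp V0_sum)
  then have "\<theta> \<le> mu0" using mu0_nonneg by auto
  then show ?thesis
    using le[OF assms] ip_self_nonneg[of V g] mult_right_mono[of \<theta> mu0] order_trans by blast
qed

text \<open>A one-sided bound on the quadratic form gives a two-sided estimate, because the sign of one of
  the two orthogonal vectors can be flipped; hence large negative adjacency eigenvalues do no harm.\<close>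

lemma mixing:
  assumes A: "A \<subseteq> block i" and B: "B \<subseteq> block (Suc i mod 3)" and i: "i < 3"
  shows "\<bar>real (card (E \<inter> A \<times> B)) - 3 * h * card A * card B / card V\<bar> \<le> mu0 * sqrt (card A * card B)"
proof -
  define j where "j = Suc i mod 3"
  define N where "N = real (card (block i))"
  have ij: "i \<noteq> j" "j < 3" using i by (auto simp: j_def mod_Suc)
  have N: "N > 0" "real (card (block j)) = N" "N = card V / 3"
    using card_block_pos[OF i] card_block[OF i] card_block[OF ij(2)] by (auto simp: N_def)
  have finAB: "finite A" "finite B" using A B finite_subset by blast+
  define iA where "iA = (\<lambda>v. if v \<in> A then 1 else 0 :: real)"
  define iB where "iB = (\<lambda>v. if v \<in> B then 1 else 0 :: real)"
  \<comment> \<open>Subtracting the densities makes the indicators orthogonal to all block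
    indicators.\<close>
  define \<alpha> \<beta> where "\<alpha> = - card A / N" and "\<beta> = - card B / N"
  define x where "x = (\<lambda>v. iA v + \<alpha> * block_ind i v)"
  define y where "y = (\<lambda>v. iB v + \<beta> * block_ind j v)"
  have AV: "A \<subseteq> V" "B \<subseteq> V" and colA: "\<And>v. v \<in> A \<Longrightarrow> col v = i" and colB: "\<And>v. v \<in> B \<Longrightarrow> col v = j"
    using A B by (auto simp: block_def j_def)
  have sums: "(\<Sum>v\<in>V. iA v) = card A" "(\<Sum>v\<in>V. iB v) = card B"
    using AV fin_V by (simp_all add: iA_def iB_def sum.If_cases Int_absorb1)
  have ipA: "ip V iA (block_ind l) = (if l = i then card A else 0)" for l
  proof -
    have "ip V iA (block_ind l) = (\<Sum>v\<in>V. if l = i then iA v else 0)"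
      unfolding ip_def using AV colA by (intro sum.cong) (auto simp: iA_def block_ind_def)
    then show ?thesis by (simp add: sums)
  qed
  have ipB: "ip V iB (block_ind l) = (if l = j then card B else 0)" for l
  proof -
    have "ip V iB (block_ind l) = (\<Sum>v\<in>V. if l = j then iB v else 0)"
      unfolding ip_def using AV colB by (intro sum.cong) (auto simp: iB_def block_ind_def)
    then show ?thesis by (simp add: sums)
  qed
  have ipbl: "ip V (block_ind l) (block_ind m) = (if l = m then card (block l) else 0)" for l m
  proof -
    have "ip V (block_ind l) (block_ind m) = (\<Sum>v\<in>V. if col v = l then (if l = m then 1 else 0) else 0)"
      unfolding ip_def by (intro sum.cong) (auto simp: block_ind_def)
    then show ?thesis by (simp add: sum_block)
  qed
  have xV0: "x \<in> V0" and yV0: "y \<in> V0"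
  proof -
    have "x \<in> supp_in V" "y \<in> supp_in V"
      using AV by (auto simp: x_def y_def supp_in_def iA_def iB_def block_ind_def)
    moreover have "ip V x (block_ind l) = 0" "ip V y (block_ind l) = 0" for l
      unfolding x_def y_def ip_linear ipA ipB ipbl
      using N(1,2) by (simp_all add: N_def[symmetric] \<alpha>_def \<beta>_def)
    ultimately show "x \<in> V0" "y \<in> V0"
      by (auto simp: V0_def orth_in_def)
  qed
  have x0: "x v = 0" if "col v \<noteq> i" for v
    using that colA by (auto simp: x_def iA_def block_ind_def)
  have y0: "y v = 0" if "col v \<noteq> j" for v
    using that colB by (auto simp: y_def iB_def block_ind_def)
  have "x v * y v = 0" for v
    using x0[of v] y0[of v] ij by (cases "col v = i") simp_all
  then have xy: "ip V x y = 0" "ip V y x = 0"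
    unfolding ip_commute[of V y] unfolding ip_def by (simp_all only: sum.neutral_const)
  \<comment> \<open>No arc lies inside a block, so the form at \<open>s * x + t * y\<close> consists
    of the cross term only.\<close>
  have E_ne: "col u \<noteq> col w" if "(u, w) \<in> E" for u w
    using col_E_cases[OF that] by auto
  have "x u * x w = 0" "y u * y w = 0" if "(u, w) \<in> E" for u w
    using x0 y0 E_ne[OF that] by (metis mult_zero_left mult_zero_right)+
  then have same: "ip V (vadj x) x = 0" "ip V (vadj y) y = 0"
    unfolding ip_vadj by (auto intro!: sum.neutral simp: mult.commute)
  have norm: "ip V x x \<le> card A" "ip V y y \<le> card B"
  proof -
    have "ip V iA iA = card A" "ip V iB iB = card B"
      unfolding sums[symmetric] ip_def by (auto simp: iA_def iB_def intro!: sum.cong)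
    then show "ip V x x \<le> card A" "ip V y y \<le> card B"
      unfolding x_def y_def ip_linear ip_commute[of V "block_ind _" iA] ip_commute[of V "block_ind _" iB] ipA ipB ipbl
      using N(1,2) by (simp_all add: N_def[symmetric] \<alpha>_def \<beta>_def field_simps)
  qed
  have "ip V (vadj iA) iB = card (E \<inter> A \<times> B)"
  proof -
    have "ip V (vadj iA) iB = (\<Sum>e\<in>E. if e \<in> A \<times> B then 1 else 0)"
      unfolding ip_vadj
    proof (intro sum.cong refl)
      fix e assume e: "e \<in> E"
      obtain u w where uw: "e = (u, w)" by (cases e)
      have "\<not> (w \<in> A \<and> u \<in> B)"
        using e colA[of w] colB[of u] col_E_cases[of u w] by (auto simp: uw j_def)
      then show "(case e of (u, w) \<Rightarrow> iA u * iB w + iA w * iB u) = (if e \<in> A \<times> B then 1 else 0)"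
        by (auto simp: uw iA_def iB_def)
    qed
    then show ?thesis using fin_E by (simp add: sum.If_cases)
  qed
  moreover have "ip V (vadj iA) (block_ind j) = h * card A" "ip V (vadj (block_ind i)) iB = h * card B"
    "ip V (vadj (block_ind i)) (block_ind j) = h * N"
  proof -
    show "ip V (vadj iA) (block_ind j) = h * card A"
      using ij by (simp add: ip_vadj_bl sums ipA)
    show "ip V (vadj (block_ind i)) iB = h * card B"
      unfolding vadj_sym[of "block_ind i"] ip_commute[of V "block_ind i"] using ij i by (simp add: ip_vadj_bl sums ipB)
    have "(\<Sum>v\<in>V. block_ind i v) = N"
      using sum_block[of i 1] by (simp add: block_ind_def N_def cong: sum.cong)
    then show "ip V (vadj (block_ind i)) (block_ind j) = h * N"
      using ij by (simp add: ip_vadj_bl ipbl)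
  qed
  moreover have cV: "real (card V) = 3 * N" using N(3) by simp
  \<comment> \<open>The product \<open>h * card A * card B / N\<close> enters twice with minus and
    once with plus; \<open>N\<close> is a third of the number of vertices.\<close>
  ultimately have p: "ip V (vadj x) y = card (E \<inter> A \<times> B) - 3 * h * card A * card B / card V"
    unfolding x_def y_def vadj_add vadj_scale ip_linear cV
    using N(1) by (simp add: \<alpha>_def \<beta>_def field_simps)
  have "\<bar>ip V (vadj x) y\<bar> \<le> mu0 * (sqrt (ip V x x) * sqrt (ip V y y))"
  proof (rule ip_bound_from_quadratic_form[OF fin_V V0_supp[OF xV0] V0_supp[OF yV0]])
    fix s t :: real
    let ?z = "\<lambda>v. s * x v + t * y v"
    have "ip V (vadj ?z) ?z \<le> mu0 * ip V ?z ?z"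
      using xV0 yV0 unfolding V0_def
      by (intro vadj_form_le[unfolded V0_def] orth_in_add orth_in_scale)
    moreover have "ip V (vadj y) x = ip V (vadj x) y"
      unfolding vadj_sym[of y] by (rule ip_commute)
    ultimately show "2 * s * t * ip V (vadj x) y \<le> mu0 * (s * s * ip V x x + t * t * ip V y y)"
      unfolding vadj_add vadj_scale ip_linear same xy by (simp add: algebra_simps)
  next
    assume "x = (\<lambda>_. 0) \<or> y = (\<lambda>_. 0)"
    then show "ip V (vadj x) y = 0" by (rule disjE) (simp_all only: ip_vadj, simp_all)
  qed
  also have "\<dots> \<le> mu0 * (sqrt (card A) * sqrt (card B))"
    using norm mu0_nonneg ip_self_nonneg by (intro mult_left_mono mult_mono) auto
  finally show ?thesis by (simp add: p real_sqrt_mult)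
qed

end

context spectral_triangles begin

section \<open>Rigidity of the extremal eigenspaces\<close>

text \<open>A locally constant function minus its mean would be an eigenvector for 0, which the
  spectral hypothesis excludes when \<open>mu0 < 2 * h\<close>.\<close>

lemma graph_connected:
  fixes g :: "'v \<Rightarrow> real"
  assumes mu: "mu0 < 2 * real h" and loc: "\<And>u w. (u, w) \<in> E \<Longrightarrow> g u = g w"
    and uv: "u \<in> V" "v \<in> V"
  shows "g u = g v"
proof -
  define m where "m = (\<Sum>v\<in>V. g v) / card V"
  define g' where "g' = (\<lambda>v. if v \<in> V then g v - m else 0)"
  have "cob g' = (\<lambda>_. 0)"
    using loc E_V by (auto simp: cob_def g'_def fun_eq_iff)
  then have "bd (cob g') = (\<lambda>v. 0 * g' v)" by (simp add: bd_def fun_eq_iff)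
  moreover have "(\<Sum>v\<in>V. g' v) = 0"
    using fin_V V_ne by (simp add: g'_def sum_subtractf m_def)
  moreover have "g' \<in> supp_in V" by (simp add: g'_def supp_in_def)
  ultimately have "g' = (\<lambda>_. 0)"
    using spec0[of g' 0] mu h_pos by (cases "g' = (\<lambda>_. 0)") auto
  then have "g' u = g' v" by simp
  then show ?thesis using uv by (simp add: g'_def)
qed

lemma cocycle_exact:
  fixes \<phi> :: "'v \<times> 'v \<Rightarrow> real"
  assumes mu: "mu1 < real k"
    and closed: "\<And>u w z. (u, w, z) \<in> T \<Longrightarrow> \<phi> (u, w) + \<phi> (w, z) + \<phi> (z, u) = 0"
  obtains g where "\<And>u w. (u, w) \<in> E \<Longrightarrow> \<phi> (u, w) = g w - g u"
proof -
  define \<delta> where "\<delta> = (\<lambda>v. cob (\<lambda>u. if u = v then 1 else 0))"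
  obtain g where g: "\<And>v. v \<in> V \<Longrightarrow> ip E (\<lambda>e. \<phi> e - (\<Sum>v\<in>V. g v * \<delta> v e)) (\<delta> v) = 0"
    using orthogonal_decomposition[OF fin_E fin_V, of \<phi> \<delta>] by blast
  define x where "x = (\<lambda>e. if e \<in> E then \<phi> e - cob g e else 0)"
  have cob_g: "(\<Sum>v\<in>V. g v * \<delta> v e) = cob g e" for e
  proof -
    obtain u w where e: "e = (u, w)" by (cases e)
    have "(\<Sum>v\<in>V. g v * \<delta> v e)
        = (if e \<in> E then (\<Sum>v\<in>V. if v = w then g v else 0) - (\<Sum>v\<in>V. if v = u then g v else 0) else 0)"
      by (auto simp: \<delta>_def cob_def e sum_subtractf[symmetric] algebra_simps intro!: sum.cong)
    then show ?thesis using fin_V E_V[of u w] by (auto simp: cob_def e)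
  qed
  have x_supp: "x \<in> supp_in E" by (simp add: x_def supp_in_def)
  have bd_x: "bd x = (\<lambda>_. 0)"
  proof
    fix v
    show "bd x v = 0"
    proof (cases "v \<in> V")
      case True
      have "bd x v = ip E (\<delta> v) x" using True by (simp add: bd_eq_ip \<delta>_def)
      also have "\<dots> = ip E (\<lambda>e. \<phi> e - cob g e) (\<delta> v)"
        unfolding ip_commute[of E "\<delta> v"] by (rule ip_cong) (auto simp: x_def)
      finally show ?thesis using g[OF True] by (simp add: cob_g)
    next
      case False
      then show ?thesis using bd_supp by (auto simp: supp_in_def)
    qed
  qed
  have x_closed: "x (w, z) + x (z, u) = - x (u, w)" if "(u, w, z) \<in> T" for u w z
    using closed[OF that] T_edges[OF that] by (simp add: x_def cob_def)
  have "tri_adj x e = - real k * x e" for e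
  proof (cases "e \<in> E")
    case True
    obtain u w where e: "e = (u, w)" by (cases e)
    have "tri_adj x e = (\<Sum>z\<in>third u w. - x (u, w))"
      unfolding tri_adj_def e by (intro sum.cong) (auto simp: third_def x_closed)
    then show ?thesis using True by (simp add: e card_nbrs)
  next
    case False
    then show ?thesis by (simp add: tri_adj_outside x_def)
  qed
  then have "tri_adj x = (\<lambda>e. - real k * x e)" by blast
  then have "x = (\<lambda>_. 0)"
    using spec1[OF x_supp _ bd_x, of "- real k"] mu mu1_nonneg k_pos by (cases "x = (\<lambda>_. 0)") auto
  then have "x e = 0" for e by simp
  then have "\<phi> (u, w) = g w - g u" if "(u, w) \<in> E" for u w
    using that unfolding x_def cob_def by (metis diff_eq_diff_eq diff_self fst_conv snd_conv)
  then show thesis using that by blast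
qed

text \<open>The form that is \<open>\<plusminus>1\<close> on the arcs joining \<open>v\<close> to \<open>K\<close> is closed, hence exact. The level set
  \<open>W\<close> of its potential is joined to the rest of the graph through \<open>v\<close> only, and counting arcs
  between two blocks of \<open>W\<close> shows that \<open>h\<close> divides the number of out-neighbours of \<open>v\<close> in \<open>K\<close>.\<close>

lemma link_connected:
  assumes mu: "mu1 < real k" and v: "v \<in> V"
    and K: "\<And>w z. (v, w, z) \<in> T \<Longrightarrow> w \<in> K \<longleftrightarrow> z \<in> K"
    and w0: "w0 \<in> out v \<inter> K"
  shows "out v \<subseteq> K"
proof -
  define \<phi> :: "'v \<times> 'v \<Rightarrow> real" where
    "\<phi> = (\<lambda>(u, w). (if u = v \<and> w \<in> K then 1 else 0) - (if w = v \<and> u \<in> K then 1 else 0))"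
  have E_irrefl: "(u, u) \<notin> E" for u using E_asym by blast
  \<comment> \<open>In a triangle through \<open>v\<close> the other two vertices are both in
    \<open>K\<close> or both outside, and the two arcs at \<open>v\<close> carry opposite
    values.\<close>
  have "\<phi> (u, w) + \<phi> (w, z) + \<phi> (z, u) = 0" if t: "(u, w, z) \<in> T" for u w z
  proof -
    have "u \<noteq> w" "w \<noteq> z" "z \<noteq> u" using T_edges[OF t] E_irrefl by auto
    then show ?thesis
      using t T_rot[OF t] T_rot[OF T_rot[OF t]] K by (auto simp: \<phi>_def)
  qed
  then obtain g where g: "\<And>u w. (u, w) \<in> E \<Longrightarrow> \<phi> (u, w) = g w - g u"
    using cocycle_exact[OF mu, of \<phi>] by blast
  define W where "W = (\<lambda>i. {u \<in> block i. g u = g v + 1})"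
  define i where "i = col v"
  have i: "i < 3" using col_less[OF v] by (simp add: i_def)
  have fin_W: "finite (W j)" for j by (simp add: W_def)
  have out_v: "w \<in> W (Suc i mod 3) \<longleftrightarrow> w \<in> K" if "(v, w) \<in> E" for w
  proof -
    have "w \<noteq> v" using that E_irrefl by auto
    then show ?thesis
      using g[OF that] col_E[OF that] E_V(2)[OF that]
      by (auto simp: \<phi>_def W_def block_def i_def split: if_splits)
  qed
  have out_other: "w \<in> W (Suc i mod 3) \<longleftrightarrow> u \<in> W i" if "(u, w) \<in> E" "u \<noteq> v" for u w
  proof (cases "w = v")
    case True
    then have "v \<notin> W (Suc i mod 3)" "col u \<noteq> i"
      using col_E_cases[OF that(1)] by (auto simp: W_def i_def)
    then show ?thesis using True by (auto simp: W_def block_def)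
  next
    case False
    then have "g u = g w" using g[OF that(1)] that(2) by (simp add: \<phi>_def)
    then show ?thesis using col_E_iff[OF that(1) i] E_V[OF that(1)] by (auto simp: W_def block_def)
  qed
  have v_notin: "v \<notin> W i" by (simp add: W_def)
  \<comment> \<open>These arcs are counted by heads, giving a multiple of \<open>h\<close>, and by
    tails, where the arcs from \<open>v\<close> into \<open>K\<close> come on top of a multiple of
    \<open>h\<close>.\<close>
  let ?F = "{e \<in> E. snd e \<in> W (Suc i mod 3)}"
  have "?F = (\<Union>w\<in>W (Suc i mod 3). (\<lambda>u. (u, w)) ` inn w)"
    by (auto simp: inn_def)
  also have "card \<dots> = (\<Sum>w\<in>W (Suc i mod 3). card ((\<lambda>u. (u, w)) ` inn w))"
    by (rule card_UN_disjoint) (auto simp: fin_W)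
  also have "\<dots> = (\<Sum>w\<in>W (Suc i mod 3). h)"
    by (intro sum.cong) (auto simp: card_image inj_on_def card_nbrs W_def block_def)
  finally have c1: "card ?F = h * card (W (Suc i mod 3))" by simp
  have "?F = (\<Union>u\<in>W i. (\<lambda>w. (u, w)) ` out u) \<union> Pair v ` (out v \<inter> K)"
    using out_v out_other v_notin by (fastforce simp: out_def)
  moreover have "(\<Union>u\<in>W i. (\<lambda>w. (u, w)) ` out u) \<inter> Pair v ` (out v \<inter> K) = {}"
    using v_notin by auto
  ultimately have "card ?F = card (\<Union>u\<in>W i. (\<lambda>w. (u, w)) ` out u) + card (Pair v ` (out v \<inter> K))"
    using fin_W by (simp add: card_Un_disjoint)
  also have "card (\<Union>u\<in>W i. (\<lambda>w. (u, w)) ` out u) = (\<Sum>u\<in>W i. card ((\<lambda>w. (u, w)) ` out u))"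
    by (rule card_UN_disjoint) (auto simp: fin_W)
  also have "\<dots> = (\<Sum>u\<in>W i. h)"
    by (intro sum.cong) (auto simp: card_image inj_on_def card_nbrs W_def block_def)
  also have "card (Pair v ` (out v \<inter> K)) = card (out v \<inter> K)"
    by (simp add: card_image inj_on_def)
  finally have "h * card (W (Suc i mod 3)) = h * card (W i) + card (out v \<inter> K)"
    using c1 by simp
  then have "h dvd card (out v \<inter> K)"
    by (metis dvd_add_right_iff dvd_triv_left)
  moreover have "card (out v \<inter> K) > 0" using w0 by (auto simp: card_gt_0_iff)
  \<comment> \<open>A positive multiple of \<open>h\<close> inside a set of size \<open>h\<close>
    exhausts it.\<close>
  ultimately have "h \<le> card (out v \<inter> K)" by (simp add: dvd_imp_le)
  then have "out v \<inter> K = out v"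
    using card_nbrs(2)[OF v] by (intro card_seteq) auto
  then show ?thesis by blast
qed

text \<open>Consecutive arcs at a vertex share their value, so connected links make
  \<open>\<phi>\<close> constant on the arcs at each vertex; connectedness of the graph then makes
  these constants equal.\<close>

lemma const_on_triangles_imp_const:
  fixes \<phi> :: "'v \<times> 'v \<Rightarrow> real"
  assumes mu: "mu0 < 2 * real h" "mu1 < real k"
    and const: "\<And>u w z. (u, w, z) \<in> T \<Longrightarrow> \<phi> (u, w) = \<phi> (w, z)"
  obtains c where "\<And>e. e \<in> E \<Longrightarrow> \<phi> e = c"
proof -
  define w0 where "w0 = (\<lambda>v. SOME w. w \<in> out v)"
  have w0: "w0 v \<in> out v" if "v \<in> V" for v
    unfolding w0_def some_in_eq using card_nbrs(2)[OF that] h_pos by auto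
  define \<gamma> where "\<gamma> = (\<lambda>v. \<phi> (v, w0 v))"
  have out: "\<phi> (v, w) = \<gamma> v" if "(v, w) \<in> E" for v w
  proof -
    \<comment> \<open>The link joins out-neighbours to in-neighbours, so both kinds are
      collected.\<close>
    let ?K = "{w. (v, w) \<in> E \<and> \<phi> (v, w) = \<gamma> v \<or> (w, v) \<in> E \<and> \<phi> (w, v) = \<gamma> v}"
    have "out v \<subseteq> ?K"
    proof (rule link_connected[OF mu(2)])
      show "v \<in> V" using that E_V by blast
      then show "w0 v \<in> out v \<inter> ?K" using w0[of v] by (auto simp: \<gamma>_def out_def)
      fix w z assume t: "(v, w, z) \<in> T"
      then show "w \<in> ?K \<longleftrightarrow> z \<in> ?K"
        using T_edges[OF t] E_asym[OF T_edges(1)[OF t]] E_asym[OF T_edges(3)[OF t]]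
          const[OF t] const[OF T_rot[OF t]] by simp
    qed
    then show ?thesis using that E_asym[OF that] by (auto simp: out_def)
  qed
  have inn: "\<phi> (u, w) = \<gamma> w" if "(u, w) \<in> E" for u w
  proof -
    have "third u w \<noteq> {}" using card_nbrs(1)[OF that] k_pos by auto
    then obtain z where t: "(u, w, z) \<in> T" by (auto simp: third_def)
    then show ?thesis using const[OF t] out[OF T_edges(2)[OF t]] by simp
  qed
  obtain v where v: "v \<in> V" using V_ne by blast
  have "\<phi> e = \<gamma> v" if "e \<in> E" for e
  proof -
    obtain u w where e: "e = (u, w)" by (cases e)
    have "\<gamma> u' = \<gamma> w'" if "(u', w') \<in> E" for u' w'
      using out[OF that] inn[OF that] by simp
    moreover have "u \<in> V" using that E_V by (simp add: e)
    ultimately have "\<gamma> u = \<gamma> v"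
      by (rule graph_connected[OF mu(1) _ _ v])
    then show ?thesis using out that by (simp add: e)
  qed
  then show thesis using that by blast
qed

text \<open>\<open>2 * k\<close> is the extreme case of Cauchy-Schwarz: the squared differences of
  \<open>x\<close> on consecutive arcs of triangles sum to zero. Thus \<open>x\<close> is constant,
  and orthogonality to a type function makes it zero.\<close>

lemma no_top_edge_eigenvector:
  fixes x :: "'v \<times> 'v \<Rightarrow> real"
  assumes mu: "mu0 < 2 * real h" "mu1 < real k"
    and x: "x \<in> E0" "tri_adj x = (\<lambda>e. 2 * real k * x e)"
  shows "x = (\<lambda>_. 0)"
proof -
  have sq: "(\<Sum>(u, w, z)\<in>T. x (u, w) * x (u, w)) = real k * ip E x x"
    unfolding sum_T ip_E sum_distrib_left by (auto simp: card_nbrs intro!: sum.cong)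
  have "ip E (tri_adj x) x = 2 * (\<Sum>(u, w, z)\<in>T. x (u, w) * x (w, z))"
    unfolding ip_tri_adj_left by (simp add: mult.commute)
  moreover have "ip E (tri_adj x) x = 2 * real k * ip E x x"
    unfolding x(2) by (simp add: ip_scale_left)
  moreover have "(\<Sum>(u, w, z)\<in>T. (x (u, w) - x (w, z))\<^sup>2)
      = (\<Sum>(u, w, z)\<in>T. x (u, w) * x (u, w)) + (\<Sum>(u, w, z)\<in>T. x (w, z) * x (w, z))
        - 2 * (\<Sum>(u, w, z)\<in>T. x (u, w) * x (w, z))"
    by (simp add: case_prod_beta' sum.distrib[symmetric] sum_subtractf[symmetric] sum_distrib_left
        power2_eq_square algebra_simps)
  moreover have "(\<Sum>(u, w, z)\<in>T. x (w, z) * x (w, z)) = (\<Sum>(u, w, z)\<in>T. x (u, w) * x (u, w))"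
    using sum_T_rot[of "\<lambda>u w z. x (u, w) * x (u, w)"] by simp
  ultimately have "(\<Sum>(u, w, z)\<in>T. (x (u, w) - x (w, z))\<^sup>2) = 0"
    using sq by simp
  then have "\<forall>t\<in>T. (case t of (u, w, z) \<Rightarrow> (x (u, w) - x (w, z))\<^sup>2) = 0"
    using fin_T by (subst (asm) sum_nonneg_eq_0_iff) auto
  then have "x (u, w) = x (w, z)" if "(u, w, z) \<in> T" for u w z
    using that by fastforce
  then obtain c where c: "\<And>e. e \<in> E \<Longrightarrow> x e = c"
    using const_on_triangles_imp_const[OF mu] by blast
  have "0 = ip E x (type_ind 0)" using x(1) by (simp add: E0_def orth_in_def)
  also have "\<dots> = c * ip E (type_ind 0) (type_ind 0)"
    unfolding ip_def sum_distrib_left by (intro sum.cong) (auto simp: c type_ind_def)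
  finally have "c = 0" using card_block_pos[of 0] h_pos by (auto simp: ip_ty_self)
  then show ?thesis using c E0_supp[OF x(1)] by (auto simp: supp_in_def fun_eq_iff)
qed

text \<open>The eigenvalue corresponds to \<open>- h\<close> for adjacency, which makes the sum of
  the squares of \<open>g u + g w + g z\<close> over triangles vanish. So \<open>g\<close> sums to
  zero on triangles, and this forces it to be constant on each block.\<close>

lemma no_top_vertex_eigenvector:
  fixes g :: "'v \<Rightarrow> real"
  assumes mu: "mu0 < 2 * real h" "mu1 < real k"
    and g: "g \<in> V0" "bd (cob g) = (\<lambda>v. 3 * real h * g v)"
  shows "g = (\<lambda>_. 0)"
proof -
  have vadj: "vadj g v = - real h * g v" if "v \<in> V" for v
    using bd_cob[OF that, of g] g(2) by (simp add: algebra_simps)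
  have sqE: "(\<Sum>(u, w)\<in>E. g u * g u) = real h * ip V g g"
    unfolding sum_E_out ip_def sum_distrib_left by (auto simp: card_nbrs intro!: sum.cong)
  have sq: "(\<Sum>(u, w, z)\<in>T. g u * g u) = real k * (real h * ip V g g)"
    unfolding sum_T sqE[symmetric] sum_distrib_left by (auto simp: card_nbrs intro!: sum.cong)
  have "ip V (vadj g) g = 2 * (\<Sum>(u, w)\<in>E. g u * g w)"
    unfolding ip_vadj sum_distrib_left by (auto intro!: sum.cong)
  moreover have "ip V (vadj g) g = - real h * ip V g g"
    unfolding ip_def sum_distrib_left using vadj by (auto intro!: sum.cong)
  moreover have "(\<Sum>(u, w, z)\<in>T. g u * g w) = real k * (\<Sum>(u, w)\<in>E. g u * g w)"
    unfolding sum_T sum_distrib_left by (auto simp: card_nbrs intro!: sum.cong)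
  ultimately have "2 * (\<Sum>(u, w)\<in>E. g u * g w) = - real h * ip V g g"
    and "(\<Sum>(u, w, z)\<in>T. g u * g w) = real k * (\<Sum>(u, w)\<in>E. g u * g w)"
    by linarith+
  then have cross: "2 * (\<Sum>(u, w, z)\<in>T. g u * g w) = - (real k * (real h * ip V g g))"
    by (metis mult.left_commute mult_minus_left mult_minus_right)
  have rots: "(\<Sum>(u, w, z)\<in>T. F u w z) = (\<Sum>(u, w, z)\<in>T. F w z u)"
    "(\<Sum>(u, w, z)\<in>T. F u w z) = (\<Sum>(u, w, z)\<in>T. F z u w)" for F :: "'v \<Rightarrow> 'v \<Rightarrow> 'v \<Rightarrow> real"
    using sum_T_rot[of F] sum_T_rot[of "\<lambda>u w z. F w z u"] by simp_all
  have "(\<Sum>(u, w, z)\<in>T. (g u + g w + g z)\<^sup>2)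
     = (\<Sum>(u, w, z)\<in>T. g u * g u) + (\<Sum>(u, w, z)\<in>T. g w * g w) + (\<Sum>(u, w, z)\<in>T. g z * g z)
       + 2 * ((\<Sum>(u, w, z)\<in>T. g u * g w) + (\<Sum>(u, w, z)\<in>T. g w * g z) + (\<Sum>(u, w, z)\<in>T. g z * g u))"
    by (simp add: case_prod_beta' sum.distrib[symmetric] sum_distrib_left
        power2_eq_square algebra_simps)
  also have "\<dots> = 0"
    using sq cross rots[of "\<lambda>u w z. g u * g u"] rots[of "\<lambda>u w z. g u * g w"] by simp
  finally have "\<forall>t\<in>T. (case t of (u, w, z) \<Rightarrow> (g u + g w + g z)\<^sup>2) = 0"
    using fin_T by (subst (asm) sum_nonneg_eq_0_iff) auto
  then have sum0: "g u + g w + g z = 0" if "(u, w, z) \<in> T" for u w z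
    using that by fastforce
  show ?thesis
  proof
    fix v
    show "g v = 0"
    proof (cases "v \<in> V")
      case True
      define i where "i = col v"
      \<comment> \<open>Since \<open>g\<close> sums to zero on triangles, this is the value of \<open>g\<close> at the vertex of colour \<open>i\<close>.\<close>
      define \<phi> where "\<phi> = (\<lambda>(u, w). if col u = i then g u else if col w = i then g w else - g u - g w)"
      have "\<phi> (u, w) = \<phi> (w, z)" if t: "(u, w, z) \<in> T" for u w z
        using sum0[OF t] col_T_cases[OF t] col_less[OF True] by (auto simp: \<phi>_def i_def)
      then obtain c where c: "\<And>e. e \<in> E \<Longrightarrow> \<phi> e = c"
        using const_on_triangles_imp_const[OF mu] by blast
      have gc: "g u = c" if u: "u \<in> V" "col u = i" for u
      proof -
        have "out u \<noteq> {}" using card_nbrs(2)[OF u(1)] h_pos by auto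
        then obtain w where "(u, w) \<in> E" by (auto simp: out_def)
        then show ?thesis using c[of "(u, w)"] u by (simp add: \<phi>_def)
      qed
      have i: "i < 3" using col_less[OF True] by (simp add: i_def)
      then have "0 = ip V g (block_ind i)" using g(1) by (simp add: V0_def orth_in_def)
      also have "\<dots> = (\<Sum>v\<in>V. if col v = i then c else 0)"
        unfolding ip_def by (intro sum.cong) (auto simp: block_ind_def gc)
      finally have "c = 0" using card_block_pos[OF i] by (auto simp: sum_block)
      then show ?thesis using gc[OF True] by (simp add: i_def)
    next
      case False
      then show ?thesis using V0_supp[OF g(1)] by (simp add: supp_in_def)
    qed
  qed
qed

section \<open>The spectral bound\<close>

text \<open>The first summand bounds eigenvalues of \<open>walk_op\<close> whose eigenvectors have
  nonzero boundary, the second those with eigenvectors in the kernel of \<open>bd\<close>.\<close>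

definition err :: real where
  "err = (real k)\<^sup>2 * mu0 / real h + (real k + mu1) * mu1"

text \<open>The quadratic polynomial in \<open>tri_adj\<close> that kills \<open>x\<close> splits
  over the reals, since completing the square turns its discriminant into a norm. Either
  \<open>x\<close> is an eigenvector for \<open>m2\<close>, or \<open>tri_adj x - m2 * x\<close> is
  one for \<open>m1\<close>.\<close>

lemma tri_adj_quadratic_factor:
  fixes x :: "'v \<times> 'v \<Rightarrow> real" and \<nu> :: real
  assumes x: "x \<in> E0" "x \<noteq> (\<lambda>_. 0)" "bd x = (\<lambda>_. 0)"
    and eig: "\<And>e. tri_adj (tri_adj x) e - real k * tri_adj x e = \<nu> * x e"
  obtains y and m :: real where "y \<in> E0" "y \<noteq> (\<lambda>_. 0)" "bd y = (\<lambda>_. 0)" "tri_adj y = (\<lambda>e. m * y e)"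
    "\<nu> = m * m - real k * m"
proof -
  define D where "D = (real k)\<^sup>2 / 4 + \<nu>"
  define z where "z = (\<lambda>e. tri_adj x e - (real k / 2) * x e)"
  have "ip E z z = ip E (\<lambda>e. tri_adj (tri_adj x) e - real k * tri_adj x e) x + (real k)\<^sup>2 / 4 * ip E x x"
    unfolding z_def ip_linear tri_adj_sym[of "tri_adj x"] ip_commute[of E x "tri_adj x"]
    by (simp add: power2_eq_square algebra_simps)
  also have "\<dots> = D * ip E x x"
    by (simp add: eig ip_linear D_def algebra_simps)
  finally have "0 \<le> D * ip E x x" using ip_self_nonneg[of E z] by simp
  moreover have "ip E x x > 0" using ip_self_pos[OF fin_E E0_supp] x by blast
  ultimately have D: "D \<ge> 0" by (simp add: zero_le_mult_iff)
  define m1 m2 where "m1 = real k / 2 + sqrt D" and "m2 = real k / 2 - sqrt D"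
  have m: "m1 + m2 = real k" "m1 * m2 = - \<nu>"
    using D by (simp_all add: m1_def m2_def algebra_simps D_def power2_eq_square)
  have nu: "\<nu> = m1 * m1 - real k * m1" "\<nu> = m2 * m2 - real k * m2"
    using m by (simp_all add: algebra_simps flip: m(1))
  define y where "y = (\<lambda>e. tri_adj x e - m2 * x e)"
  show thesis
  proof (cases "y = (\<lambda>_. 0)")
    case True
    then have "tri_adj x = (\<lambda>e. m2 * x e)" by (simp add: y_def fun_eq_iff)
    then show thesis using that x nu by blast
  next
    case False
    have "y \<in> E0" unfolding y_def by (intro E0_diff E0_scale E0_tri_adj x)
    moreover have "bd y = (\<lambda>_. 0)"
      by (simp add: y_def bd_diff bd_scale bd_tri_adj x(3))
    moreover have "tri_adj y = (\<lambda>e. m1 * y e)"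
    proof
      fix e
      have "tri_adj y e = (m1 + m2) * tri_adj x e + \<nu> * x e - m2 * tri_adj x e"
        using eig[of e] by (simp add: y_def tri_adj_diff tri_adj_scale m algebra_simps)
      also have "\<dots> = m1 * tri_adj x e - m1 * m2 * x e"
        unfolding m(2) by (simp add: algebra_simps)
      also have "\<dots> = m1 * y e"
        by (simp add: y_def algebra_simps)
      finally show "tri_adj y e = m1 * y e" .
    qed
    ultimately show thesis using that False nu by blast
  qed
qed

lemma walk_op_eigenvalue:
  fixes x :: "'v \<times> 'v \<Rightarrow> real" and \<nu> :: real
  assumes mu: "mu0 < 2 * real h" "mu1 < real k"
    and x: "x \<in> E0" "x \<noteq> (\<lambda>_. 0)" "walk_op x = (\<lambda>e. \<nu> * x e)"
  shows "\<bar>\<nu>\<bar> \<le> err"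
proof (cases "bd x = (\<lambda>_. 0)")
  case True
  then have "cob (bd x) = (\<lambda>_. 0)" by (simp add: cob_def fun_eq_iff)
  then have "tri_adj (tri_adj x) e - real k * tri_adj x e = \<nu> * x e" for e
    using fun_cong[OF x(3), of e] by (simp add: walk_op_def)
  then obtain y m where y: "y \<in> E0" "y \<noteq> (\<lambda>_. 0)" "bd y = (\<lambda>_. 0)" "tri_adj y = (\<lambda>e. m * y e)"
    and nu: "\<nu> = m * m - real k * m"
    using tri_adj_quadratic_factor[OF x(1,2) True] by blast
  have "\<bar>m\<bar> \<le> mu1 \<or> \<bar>m - real k\<bar> \<le> mu1 \<or> m = 2 * real k"
    using spec1[OF E0_supp] y by blast
  moreover have "m \<noteq> 2 * real k" using no_top_edge_eigenvector[OF mu y(1)] y by auto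
  \<comment> \<open>If one of the factors of \<open>m * (m - k)\<close> is small, the other is at
    most \<open>k + mu1\<close> in absolute value.\<close>
  ultimately have "\<bar>m\<bar> \<le> mu1 \<and> \<bar>m - real k\<bar> \<le> real k + mu1 \<or> \<bar>m\<bar> \<le> real k + mu1 \<and> \<bar>m - real k\<bar> \<le> mu1"
    by (auto simp: abs_le_iff)
  then have "\<bar>m\<bar> * \<bar>m - real k\<bar> \<le> (real k + mu1) * mu1"
    using mu1_nonneg mult_mono[of "\<bar>m\<bar>" mu1 "\<bar>m - real k\<bar>" "real k + mu1"]
      mult_mono[of "\<bar>m\<bar>" "real k + mu1" "\<bar>m - real k\<bar>" mu1] by (auto simp: mult.commute)
  moreover have "\<bar>\<nu>\<bar> = \<bar>m\<bar> * \<bar>m - real k\<bar>"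
    by (simp add: nu abs_mult[symmetric] algebra_simps)
  ultimately show ?thesis using mu0_nonneg by (simp add: err_def add_increasing)
next
  case False
  \<comment> \<open>The Laplacian eigenvalue solving
    \<open>\<nu> = k^2 / h * (2 * h - ev)\<close>.\<close>
  define ev where "ev = (2 * (real k)\<^sup>2 - \<nu>) * real h / (real k)\<^sup>2"
  have "\<nu> * bd x v = 2 * (real k)\<^sup>2 * bd x v - (real k)\<^sup>2 / real h * bd (cob (bd x)) v" for v
    using bd_walk_op[of x v] by (simp add: x(3) bd_scale)
  then have eig: "bd (cob (bd x)) = (\<lambda>v. ev * bd x v)"
    using h_pos k_pos by (auto simp: ev_def field_simps fun_eq_iff)
  have "\<bar>ev - 2 * real h\<bar> \<le> mu0 \<or> ev = 3 * real h"
    using E0_bd[OF x(1)] by (intro spec0[OF bd_supp False V0_sum eig])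
  moreover have "ev \<noteq> 3 * real h"
    using no_top_vertex_eigenvector[OF mu E0_bd[OF x(1)]] eig False by auto
  ultimately have "\<bar>ev - 2 * real h\<bar> \<le> mu0" by blast
  moreover have "\<nu> = (real k)\<^sup>2 / real h * (2 * real h - ev)"
    using h_pos k_pos by (simp add: ev_def field_simps)
  then have "\<bar>\<nu>\<bar> = (real k)\<^sup>2 / real h * \<bar>ev - 2 * real h\<bar>"
    by (simp add: abs_mult abs_minus_commute)
  ultimately have "\<bar>\<nu>\<bar> \<le> (real k)\<^sup>2 / real h * mu0" by (simp add: mult_left_mono del: times_divide_eq_left)
  then show ?thesis using mu1_nonneg by (simp add: err_def add_increasing2)
qed

text \<open>Top eigenvalues of \<open>walk_op\<close> and of its negative bound the form on both
  sides. Adding the upper bound at \<open>s * x + t * y\<close> to the lower one at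
  \<open>s * x - t * y\<close> cancels the inner product of \<open>x\<close> and \<open>y\<close>,
  which need not be orthogonal.\<close>

lemma walk_op_bound:
  assumes mu: "mu0 < 2 * real h" "mu1 < real k" and xy: "x \<in> E0" "y \<in> E0"
  shows "\<bar>ip E (walk_op x) y\<bar> \<le> err * (sqrt (ip E x x) * sqrt (ip E y y))"
proof -
  have form: "\<sigma> * ip E (walk_op z) z \<le> err * ip E z z" if z: "z \<in> E0" and \<sigma>: "\<sigma> = 1 \<or> \<sigma> = - 1"
    for z and \<sigma> :: real
  proof (cases "z = (\<lambda>_. 0)")
    case True
    then show ?thesis by (simp add: ip_def)
  next
    case False
    let ?S = "\<lambda>x e. \<sigma> * walk_op x e"
    obtain x \<theta> where x: "x \<in> E0" "x \<noteq> (\<lambda>_. 0)" "?S x = (\<lambda>e. \<theta> * x e)"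
      and le: "\<And>y. y \<in> E0 \<Longrightarrow> ip E (?S y) y \<le> \<theta> * ip E y y"
    proof (rule rayleigh_max_eigenvector[of E E0 ?S z])
      show "E0 \<subseteq> supp_in E" "closed E0" by (auto simp: E0_supp E0_def closed_orth_in)
      show "continuous_on UNIV (\<lambda>x. \<sigma> * walk_op x i)" for i
        by (intro continuous_intros cont_walk_op)
      show "ip E (?S x) y = ip E x (?S y)" for x y
        by (simp add: ip_linear walk_op_sym)
    qed (use z False in \<open>auto simp: fin_E E0_add E0_scale E0_walk_op walk_op_add walk_op_scale algebra_simps\<close>)
    have "walk_op x e = \<sigma> * \<theta> * x e" for e
      using fun_cong[OF x(3), of e] \<sigma> by auto
    then have "\<bar>\<sigma> * \<theta>\<bar> \<le> err"
      using x by (intro walk_op_eigenvalue[OF mu]) auto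
    then have "\<theta> \<le> err" using \<sigma> by auto
    then show ?thesis
      using le[OF z] mult_right_mono[of \<theta> err "ip E z z"] ip_self_nonneg[of E z]
      by (simp add: ip_linear)
  qed
  show ?thesis
  proof (rule ip_bound_from_quadratic_form[OF fin_E E0_supp[OF xy(1)] E0_supp[OF xy(2)]])
    fix s t :: real
    let ?p = "\<lambda>e. s * x e + t * y e" and ?q = "\<lambda>e. s * x e - t * y e"
    have "ip E (walk_op ?p) ?p \<le> err * ip E ?p ?p" "- ip E (walk_op ?q) ?q \<le> err * ip E ?q ?q"
      using form[of ?p 1] form[of ?q "- 1"] xy by (simp_all add: E0_add E0_diff E0_scale)
    moreover have "ip E (walk_op y) x = ip E (walk_op x) y"
      by (simp add: walk_op_sym[of y] ip_commute[of E y])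
    moreover have "walk_op ?q = (\<lambda>e. s * walk_op x e - t * walk_op y e)"
      using walk_op_add[of "\<lambda>e. s * x e" "\<lambda>e. - t * y e"] walk_op_scale[of s x] walk_op_scale[of "- t" y]
      by simp
    ultimately show "2 * s * t * ip E (walk_op x) y \<le> err * (s * s * ip E x x + t * t * ip E y y)"
      by (simp add: walk_op_add walk_op_scale ip_linear ip_commute[of E y x] algebra_simps)
  qed (auto simp: ip_walk_op, simp_all add: ip_def tri_adj_def bd_def)
qed

end

section \<open>Counting pairs of triangles\<close>

text \<open>The arithmetic that joins mixing to the spectral bound. For \<open>err < k^2\<close> the
  arc counts are replaced by their expected values; otherwise the trivial bound on \<open>F\<close>
  and on the main term suffices.\<close>

lemma final_estimate:
  fixes a b c d n h k mu0 e1 e2 F err :: real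
  assumes nonneg: "a \<ge> 0" "b \<ge> 0" "c \<ge> 0" "d \<ge> 0" "mu0 \<ge> 0" "k \<ge> 0" "e1 \<ge> 0" "e2 \<ge> 0" "F \<ge> 0" "err \<ge> 0"
    and pos: "n > 0" "h > 0"
    and small: "a \<le> n / 3" "b \<le> n / 3" "c \<le> n / 3" "d \<le> n / 3"
    and mix: "\<bar>e1 - 3 * h * a * b / n\<bar> \<le> mu0 * sqrt (a * b)" "\<bar>e2 - 3 * h * c * d / n\<bar> \<le> mu0 * sqrt (c * d)"
    and triv: "F \<le> k\<^sup>2 * sqrt (e1 * e2)"
    and main: "err < k\<^sup>2 \<Longrightarrow> \<bar>F - 3 * k\<^sup>2 * e1 * e2 / (h * n)\<bar> \<le> err * sqrt (e1 * e2)"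
  shows "\<bar>F - 27 * (2 * h) * k\<^sup>2 * a * b * c * d / (2 * n ^ 3)\<bar>
    \<le> 6 * mu0 * k\<^sup>2 * sqrt (a * b * c * d) / (2 * h * n)
        * (3 * (2 * h) * (sqrt (a * b) + sqrt (c * d)) / (2 * n) + mu0)
      + err * root 4 (a * b * c * d)
        * sqrt ((3 * (2 * h) * sqrt (a * b) / (2 * n) + mu0) * (3 * (2 * h) * sqrt (c * d) / (2 * n) + mu0))"
proof -
  define p r where "p = sqrt (a * b)" and "r = sqrt (c * d)"
  have pr: "p \<ge> 0" "r \<ge> 0" "a * b = p * p" "c * d = r * r"
    using nonneg by (auto simp: p_def r_def)
  have abcd: "a * b * c * d = (p * r) * (p * r)"
    using pr by (simp add: mult.assoc)
  define X Y where "X = 3 * h * p / n + mu0" and "Y = 3 * h * r / n + mu0"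
  have XY: "X \<ge> 0" "Y \<ge> 0" using nonneg pos pr by (auto simp: X_def Y_def)
  define m1 m2 where "m1 = 3 * h * (p * p) / n" and "m2 = 3 * h * (r * r) / n"
  have m: "m1 \<ge> 0" "m2 \<ge> 0" using pos pr by (auto simp: m1_def m2_def)
  have e: "\<bar>e1 - m1\<bar> \<le> mu0 * p" "\<bar>e2 - m2\<bar> \<le> mu0 * r"
    using mix unfolding m1_def m2_def pr(3,4)[symmetric] unfolding p_def r_def
    by (simp_all add: mult.assoc)
  \<comment> \<open>Mixing used as an upper bound; it produces the two factors under the last square
    root of the claim.\<close>
  have "e1 \<le> p * X" "e2 \<le> r * Y"
    using e by (simp_all add: X_def Y_def m1_def m2_def algebra_simps abs_le_iff)
  then have "e1 * e2 \<le> (p * X) * (r * Y)"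
    using nonneg pr XY by (intro mult_mono) auto
  also have "\<dots> = (p * r) * (X * Y)" by simp
  finally have sq: "sqrt (e1 * e2) \<le> sqrt (p * r) * sqrt (X * Y)"
    by (metis real_sqrt_le_mono real_sqrt_mult)
  have root4: "root 4 (a * b * c * d) = sqrt (p * r)"
  proof -
    have "root 4 (a * b * c * d) = root (2 * 2) ((p * r) * (p * r))" by (simp add: abcd)
    also have "\<dots> = sqrt (sqrt ((p * r) * (p * r)))" by (simp only: real_root_mult_exp sqrt_def)
    finally show ?thesis using pr by simp
  qed
  have sqrt_abcd: "sqrt (a * b * c * d) = p * r" unfolding abcd using pr(1,2) by simp
  define R1 where "R1 = 6 * mu0 * k\<^sup>2 * (p * r) / (2 * h * n) * (3 * (2 * h) * (p + r) / (2 * n) + mu0)"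
  have R1: "R1 \<ge> 0" unfolding R1_def using nonneg pr pos by (intro mult_nonneg_nonneg divide_nonneg_pos add_nonneg_nonneg) auto
  define M where "M = 27 * h * k\<^sup>2 * (p * r) * (p * r) / n ^ 3"
  have M: "M \<ge> 0" unfolding M_def using nonneg pr pos by (intro mult_nonneg_nonneg divide_nonneg_pos) auto
  have M_eq: "3 * k\<^sup>2 / (h * n) * (m1 * m2) = M"
    using pos by (simp add: M_def m1_def m2_def field_simps power2_eq_square power3_eq_cube)
  have "\<bar>F - M\<bar> \<le> R1 + err * (sqrt (p * r) * sqrt (X * Y))"
  proof (cases "err < k\<^sup>2")
    case True
    define q where "q = 3 * k\<^sup>2 / (h * n) * (e1 * e2)"
    \<comment> \<open>The product is expanded around the expected arc counts \<open>m1\<close> and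
      \<open>m2\<close>.\<close>
    have "\<bar>e1 * e2 - m1 * m2\<bar> = \<bar>(e1 - m1) * (e2 - m2) + m1 * (e2 - m2) + m2 * (e1 - m1)\<bar>"
      by (simp add: algebra_simps)
    also have "\<dots> \<le> \<bar>e1 - m1\<bar> * \<bar>e2 - m2\<bar> + m1 * \<bar>e2 - m2\<bar> + m2 * \<bar>e1 - m1\<bar>"
      using m abs_triangle_ineq[of "(e1 - m1) * (e2 - m2) + m1 * (e2 - m2)" "m2 * (e1 - m1)"]
        abs_triangle_ineq[of "(e1 - m1) * (e2 - m2)" "m1 * (e2 - m2)"] by (simp add: abs_mult)
    also have "\<dots> \<le> (mu0 * p) * (mu0 * r) + m1 * (mu0 * r) + m2 * (mu0 * p)"
      using e m nonneg pr by (intro add_mono mult_mono mult_left_mono) auto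
    finally have "3 * k\<^sup>2 / (h * n) * \<bar>e1 * e2 - m1 * m2\<bar>
        \<le> 3 * k\<^sup>2 / (h * n) * ((mu0 * p) * (mu0 * r) + m1 * (mu0 * r) + m2 * (mu0 * p))"
      using pos by (intro mult_left_mono) auto
    also have "\<dots> = R1"
      using pos by (simp add: R1_def m1_def m2_def field_simps)
    finally have "\<bar>q - M\<bar> \<le> R1"
      using pos by (simp add: q_def M_eq[symmetric] right_diff_distrib[symmetric] abs_mult del: times_divide_eq_left)
    moreover have "\<bar>F - q\<bar> \<le> err * (sqrt (p * r) * sqrt (X * Y))"
      using main[OF True] mult_left_mono[OF sq nonneg(10)] by (simp add: q_def mult.assoc)
    ultimately show ?thesis using abs_triangle_ineq[of "F - q" "q - M"] by simp
  next
    case False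
    \<comment> \<open>Both \<open>F\<close> and \<open>M\<close> lie between 0 and the same bound,
      so their difference is within it.\<close>
    have "F \<le> k\<^sup>2 * (sqrt (p * r) * sqrt (X * Y))"
      using triv mult_left_mono[OF sq, of "k\<^sup>2"] by simp
    moreover have "M \<le> k\<^sup>2 * (sqrt (p * r) * sqrt (X * Y))"
    proof -
      have "p * p \<le> (n / 3) * (n / 3)" "r * r \<le> (n / 3) * (n / 3)"
        unfolding pr(3,4)[symmetric] using nonneg small pos by (simp_all only: mult_mono divide_nonneg_nonneg less_imp_le zero_le_numeral)
      then have "p \<le> n / 3" "r \<le> n / 3"
        using pos power2_le_imp_le[of p "n / 3"] power2_le_imp_le[of r "n / 3"]
        by (simp_all add: power2_eq_square)
      then have "p * r \<le> (n / 3) * (n / 3)" using pr pos by (intro mult_mono) auto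
      \<comment> \<open>Each set is at most a third of the vertices, which makes the second factor
        of \<open>M\<close> at most 1.\<close>
      then have "9 * (p * r) / n\<^sup>2 \<le> 1" using pos by (simp add: field_simps power2_eq_square)
      moreover have "M = k\<^sup>2 * (3 * h * (p * r) / n) * (9 * (p * r) / n\<^sup>2)"
        using pos by (simp add: M_def field_simps power2_eq_square power3_eq_cube)
      moreover have "k\<^sup>2 * (3 * h * (p * r) / n) \<ge> 0" using pos pr by simp
      ultimately have "M \<le> k\<^sup>2 * (3 * h * (p * r) / n)"
        using mult_left_mono[of "9 * (p * r) / n\<^sup>2" 1 "k\<^sup>2 * (3 * h * (p * r) / n)"] by simp
      moreover have "3 * h * (p * r) / n \<le> sqrt (p * r) * sqrt (X * Y)"
      proof -
        have "(3 * h * p / n) * (3 * h * r / n) \<le> X * Y"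
          unfolding X_def Y_def using nonneg pr pos by (intro mult_mono) auto
        then have "(p * r) * ((3 * h * p / n) * (3 * h * r / n)) \<le> (p * r) * (X * Y)"
          using pr by (intro mult_left_mono) auto
        then have "(3 * h * (p * r) / n) * (3 * h * (p * r) / n) \<le> (p * r) * (X * Y)"
          by (simp add: algebra_simps)
        then have "3 * h * (p * r) / n \<le> sqrt ((p * r) * (X * Y))"
          unfolding power2_eq_square[symmetric] by (rule real_le_rsqrt)
        then show ?thesis by (simp only: real_sqrt_mult)
      qed
      then have "k\<^sup>2 * (3 * h * (p * r) / n) \<le> k\<^sup>2 * (sqrt (p * r) * sqrt (X * Y))"
        by (intro mult_left_mono) auto
      ultimately show ?thesis by linarith
    qed
    moreover have "k\<^sup>2 * (sqrt (p * r) * sqrt (X * Y)) \<le> err * (sqrt (p * r) * sqrt (X * Y))"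
      using False pr XY by (intro mult_right_mono) auto
    ultimately show ?thesis using R1 M nonneg(9) by linarith
  qed
  moreover have "27 * (2 * h) * k\<^sup>2 * a * b * c * d / (2 * n ^ 3) = M"
    using abcd by (simp add: M_def algebra_simps)
  moreover have "3 * (2 * h) * p / (2 * n) + mu0 = X" "3 * (2 * h) * r / (2 * n) + mu0 = Y"
    by (simp_all add: X_def Y_def)
  ultimately show ?thesis
    unfolding root4 sqrt_abcd p_def[symmetric] r_def[symmetric] R1_def by (simp add: mult.assoc)
qed

context spectral_triangles begin

text \<open>The ordered counterpart of \<open>F2\<close>: two triangles over the base arc
  \<open>(b, c)\<close> with apexes \<open>a\<close> and \<open>d\<close>.\<close>

definition pyramids :: "'v set \<Rightarrow> 'v set \<Rightarrow> 'v set \<Rightarrow> 'v set \<Rightarrow> ('v \<times> 'v \<times> 'v \<times> 'v) set" where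
  "pyramids A B C D = {(a, b, c, d). a \<in> A \<and> b \<in> B \<and> c \<in> C \<and> d \<in> D \<and> (a, b, c) \<in> T \<and> (d, b, c) \<in> T}"

definition ind :: "'v set \<Rightarrow> 'v set \<Rightarrow> 'v \<times> 'v \<Rightarrow> real" where
  "ind A B e = (if e \<in> E \<inter> A \<times> B then 1 else 0)"

lemma third_iff: "z \<in> third u w \<longleftrightarrow> (z, u, w) \<in> T"
  using T_rot by (auto simp: third_def)

section \<open>Inner products of arc indicators\<close>

lemma ip_ind_self: "ip E (ind A B) (ind A B) = card (E \<inter> A \<times> B)"
proof -
  have "ip E (ind A B) (ind A B) = (\<Sum>e\<in>E. if e \<in> A \<times> B then 1 else 0)"
    unfolding ip_def by (intro sum.cong) (auto simp: ind_def)
  then show ?thesis using fin_E by (simp add: sum.If_cases)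
qed

lemma ip_ind_ty:
  assumes "A \<subseteq> block i"
  shows "ip E (ind A B) (type_ind j) = (if j = i then card (E \<inter> A \<times> B) else 0)"
proof -
  have "ip E (ind A B) (type_ind j) = (\<Sum>e\<in>E. if j = i then ind A B e * ind A B e else 0)"
    unfolding ip_def using assms by (intro sum.cong) (auto simp: ind_def type_ind_def block_def)
  then show ?thesis using ip_ind_self[of A B] by (simp add: ip_def)
qed

context
  fixes A B C D
  assumes A: "A \<subseteq> block 0" and B: "B \<subseteq> block 1" and C: "C \<subseteq> block 2" and D: "D \<subseteq> block 0"
    and AD: "A \<inter> D = {}"
begin

lemma cols: "v \<in> A \<Longrightarrow> col v = 0" "v \<in> B \<Longrightarrow> col v = 1" "v \<in> C \<Longrightarrow> col v = 2" "v \<in> D \<Longrightarrow> col v = 0"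
  using A B C D by (auto simp: block_def)

text \<open>Over a fixed base arc the two apexes are chosen independently among its third
  vertices.\<close>

lemma card_pyramids:
  "card (pyramids A B C D)
    = (\<Sum>(u, w)\<in>E. if u \<in> B \<and> w \<in> C then card (third u w \<inter> A) * card (third u w \<inter> D) else 0)"
proof -
  let ?S = "Sigma (E \<inter> B \<times> C) (\<lambda>(u, w). (third u w \<inter> A) \<times> (third u w \<inter> D))"
  have "bij_betw (\<lambda>(a, b, c, d). ((b, c), (a, d))) (pyramids A B C D) ?S"
    by (rule bij_betw_byWitness[of _ "\<lambda>((b, c), (a, d)). (a, b, c, d)"])
      (auto simp: pyramids_def third_iff dest: T_edges)
  then have "card (pyramids A B C D) = card ?S" by (rule bij_betw_same_card)
  also have "\<dots> = (\<Sum>e\<in>E \<inter> B \<times> C. card (third (fst e) (snd e) \<inter> A) * card (third (fst e) (snd e) \<inter> D))"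
    using fin_E by (subst card_SigmaI) (auto simp: card_cartesian_product case_prod_beta')
  also have "\<dots> = (\<Sum>e\<in>E. if e \<in> B \<times> C
      then card (third (fst e) (snd e) \<inter> A) * card (third (fst e) (snd e) \<inter> D) else 0)"
    using fin_E by (simp add: sum.inter_restrict)
  also have "\<dots> = (\<Sum>(u, w)\<in>E. if u \<in> B \<and> w \<in> C then card (third u w \<inter> A) * card (third u w \<inter> D) else 0)"
    by (intro sum.cong) (auto split: if_splits)
  finally show ?thesis .
qed

text \<open>On an arc with tail of colour 1 the two factors count its apexes in \<open>A\<close> and
  in \<open>D\<close>; on the other two types the colours make one factor vanish.\<close>

lemma ip_tri_adj_ind: "ip E (tri_adj (ind A B)) (tri_adj (ind C D)) = card (pyramids A B C D)"
proof -
  have "tri_adj (ind A B) (u, w) * tri_adj (ind C D) (u, w)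
      = real (if u \<in> B \<and> w \<in> C then card (third u w \<inter> A) * card (third u w \<inter> D) else 0)"
    if e: "(u, w) \<in> E" for u w
  proof (cases "col u = 1")
    case True
    have AB: "tri_adj (ind A B) (u, w) = (if u \<in> B then card (third u w \<inter> A) else 0)"
    proof -
      have "tri_adj (ind A B) (u, w) = (\<Sum>z\<in>third u w. if u \<in> B \<and> z \<in> A then 1 else 0)"
        unfolding tri_adj_def
      proof (intro sum.cong)
        fix z assume "z \<in> third u w"
        then have t: "(u, w, z) \<in> T" by (simp add: third_def)
        have "w \<notin> A" using col_T_cases[OF t] True cols(1)[of w] by auto
        then show "ind A B (snd (u, w), z) + ind A B (z, fst (u, w)) = (if u \<in> B \<and> z \<in> A then 1 else 0)"
          using T_edges[OF t] by (auto simp: ind_def)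
      qed auto
      then show ?thesis by (simp add: sum.If_cases)
    qed
    have CD: "tri_adj (ind C D) (u, w) = (if w \<in> C then card (third u w \<inter> D) else 0)"
    proof -
      have "tri_adj (ind C D) (u, w) = (\<Sum>z\<in>third u w. if w \<in> C \<and> z \<in> D then 1 else 0)"
        unfolding tri_adj_def
      proof (intro sum.cong)
        fix z assume "z \<in> third u w"
        then have t: "(u, w, z) \<in> T" by (simp add: third_def)
        have "z \<notin> C" using col_T_cases[OF t] True cols(3)[of z] by auto
        then show "ind C D (snd (u, w), z) + ind C D (z, fst (u, w)) = (if w \<in> C \<and> z \<in> D then 1 else 0)"
          using T_edges[OF t] by (auto simp: ind_def)
      qed auto
      then show ?thesis by (simp add: sum.If_cases)
    qed
    show ?thesis using AB CD by simp
  next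
    case False
    have "tri_adj (ind A B) (u, w) = 0 \<or> tri_adj (ind C D) (u, w) = 0"
    proof (cases "col u = 0")
      case True
      have "ind A B (w, z) + ind A B (z, u) = 0" if "z \<in> third u w" for z
      proof -
        have t: "(u, w, z) \<in> T" using that by (simp add: third_def)
        show ?thesis using col_T_cases[OF t] True cols(1)[of w] cols(1)[of z] by (auto simp: ind_def)
      qed
      then show ?thesis by (simp add: tri_adj_def)
    next
      case ne: False
      have "ind C D (w, z) + ind C D (z, u) = 0" if "z \<in> third u w" for z
      proof -
        have t: "(u, w, z) \<in> T" using that by (simp add: third_def)
        show ?thesis using col_T_cases[OF t] False ne cols(3)[of w] cols(3)[of z] by (auto simp: ind_def)
      qed
      then show ?thesis by (simp add: tri_adj_def)
    qed
    moreover have "u \<notin> B" using False cols(2) by auto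
    ultimately show ?thesis by auto
  qed
  then show ?thesis
    unfolding card_pyramids ip_E of_nat_sum by (intro sum.cong) auto
qed

text \<open>An arc from \<open>A\<close> to \<open>B\<close> following an arc from \<open>C\<close>
  to \<open>D\<close> would start in \<open>D\<close>, one preceding it would end in
  \<open>C\<close>; disjointness excludes both.\<close>

lemma ip_tri_adj_ind_ind: "ip E (tri_adj (ind A B)) (ind C D) = 0"
proof -
  have "tri_adj (ind A B) (u, w) * ind C D (u, w) = 0" if "(u, w) \<in> E" for u w
  proof (cases "u \<in> C \<and> w \<in> D")
    case True
    have "u \<notin> B" "w \<notin> A" using True cols(2,3) AD by fastforce+
    then have "tri_adj (ind A B) (u, w) = 0" by (simp add: tri_adj_def ind_def)
    then show ?thesis by simp
  next
    case False
    then have "ind C D (u, w) = 0" by (auto simp: ind_def)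
    then show ?thesis by simp
  qed
  then show ?thesis unfolding ip_E by (intro sum.neutral) auto
qed

text \<open>The boundaries live on the disjoint sets formed by \<open>A\<close>, \<open>B\<close>
  and by \<open>C\<close>, \<open>D\<close>.\<close>

lemma ip_bd_ind: "ip V (bd (ind A B)) (bd (ind C D)) = 0"
proof -
  have "bd (ind A B) v * bd (ind C D) v = 0" for v
  proof (cases "v \<in> A \<or> v \<in> B")
    case True
    then have "v \<notin> C" "v \<notin> D" using cols AD by fastforce+
    then show ?thesis by (simp add: bd_def ind_def)
  next
    case False
    then show ?thesis by (simp add: bd_def ind_def)
  qed
  then show ?thesis unfolding ip_def by (intro sum.neutral) auto
qed

text \<open>Cauchy-Schwarz over the base arcs. Apex counts are at most \<open>k\<close>, so a sum of
  their squares is at most \<open>k\<close> times their sum; that sum counts triangles on arcs from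
  \<open>A\<close> to \<open>B\<close>, with \<open>k\<close> on each arc. The other side is
  analogous.\<close>

lemma pyramids_le: "card (pyramids A B C D) \<le> k\<^sup>2 * sqrt (card (E \<inter> A \<times> B) * card (E \<inter> C \<times> D))"
proof -
  define p where "p = (\<lambda>e. if fst e \<in> B then real (card (third (fst e) (snd e) \<inter> A)) else 0)"
  define q where "q = (\<lambda>e. if snd e \<in> C then real (card (third (fst e) (snd e) \<inter> D)) else 0)"
  have le_k: "card (third u w \<inter> Z) \<le> k" if "(u, w) \<in> E" for u w Z
    using card_mono[of "third u w" "third u w \<inter> Z"] card_nbrs(1)[OF that] by auto
  have p: "(\<Sum>e\<in>E. (p e)\<^sup>2) \<le> (real k)\<^sup>2 * card (E \<inter> A \<times> B)"
  proof -
    have "(\<Sum>e\<in>E. (p e)\<^sup>2) \<le> (\<Sum>e\<in>E. real k * p e)"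
      using le_k by (intro sum_mono) (auto simp: p_def power2_eq_square mult_right_mono)
    also have "\<dots> = real k * (\<Sum>(u, w)\<in>E. \<Sum>z\<in>third u w. if z \<in> A \<and> u \<in> B then 1 else 0)"
      unfolding sum_distrib_left by (intro sum.cong) (auto simp: p_def sum.If_cases Int_def)
    also have "(\<Sum>(u, w)\<in>E. \<Sum>z\<in>third u w. if z \<in> A \<and> u \<in> B then 1 else 0 :: real)
        = (\<Sum>(u, w, z)\<in>T. if z \<in> A \<and> u \<in> B then 1 else 0)"
      by (rule sum_T[symmetric])
    also have "\<dots> = (\<Sum>(u, w, z)\<in>T. if u \<in> A \<and> w \<in> B then 1 else 0)"
      using sum_T_rot[of "\<lambda>u w z. if z \<in> A \<and> u \<in> B then 1 else 0 :: real"] .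
    also have "\<dots> = (\<Sum>e\<in>E. if e \<in> A \<times> B then real k else 0)"
      unfolding sum_T by (intro sum.cong) (auto simp: card_nbrs split: if_splits)
    also have "\<dots> = real k * card (E \<inter> A \<times> B)"
      using fin_E by (simp add: sum.If_cases)
    finally show ?thesis by (simp add: power2_eq_square mult.assoc)
  qed
  have q: "(\<Sum>e\<in>E. (q e)\<^sup>2) \<le> (real k)\<^sup>2 * card (E \<inter> C \<times> D)"
  proof -
    have "(\<Sum>e\<in>E. (q e)\<^sup>2) \<le> (\<Sum>e\<in>E. real k * q e)"
      using le_k by (intro sum_mono) (auto simp: q_def power2_eq_square mult_right_mono)
    also have "\<dots> = real k * (\<Sum>(u, w)\<in>E. \<Sum>z\<in>third u w. if w \<in> C \<and> z \<in> D then 1 else 0)"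
      unfolding sum_distrib_left by (intro sum.cong) (auto simp: q_def sum.If_cases Int_def)
    also have "(\<Sum>(u, w)\<in>E. \<Sum>z\<in>third u w. if w \<in> C \<and> z \<in> D then 1 else 0 :: real)
        = (\<Sum>(u, w, z)\<in>T. if w \<in> C \<and> z \<in> D then 1 else 0)"
      by (rule sum_T[symmetric])
    also have "\<dots> = (\<Sum>(u, w, z)\<in>T. if u \<in> C \<and> w \<in> D then 1 else 0)"
      using sum_T_rot[of "\<lambda>u w z. if u \<in> C \<and> w \<in> D then 1 else 0 :: real"] by simp
    also have "\<dots> = (\<Sum>e\<in>E. if e \<in> C \<times> D then real k else 0)"
      unfolding sum_T by (intro sum.cong) (auto simp: card_nbrs split: if_splits)
    also have "\<dots> = real k * card (E \<inter> C \<times> D)"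
      using fin_E by (simp add: sum.If_cases)
    finally show ?thesis by (simp add: power2_eq_square mult.assoc)
  qed
  have "real (card (pyramids A B C D)) = (\<Sum>e\<in>E. p e * q e)"
    unfolding card_pyramids of_nat_sum by (intro sum.cong) (auto simp: p_def q_def)
  also have "\<dots> \<le> sqrt ((\<Sum>e\<in>E. (p e)\<^sup>2) * (\<Sum>e\<in>E. (q e)\<^sup>2))"
    by (rule real_le_rsqrt) (rule Cauchy_Schwarz_ineq_sum)
  also have "\<dots> \<le> sqrt (((real k)\<^sup>2 * card (E \<inter> A \<times> B)) * ((real k)\<^sup>2 * card (E \<inter> C \<times> D)))"
    using p q by (intro real_sqrt_le_mono mult_mono sum_nonneg) auto
  also have "\<dots> = (real k)\<^sup>2 * sqrt (card (E \<inter> A \<times> B) * card (E \<inter> C \<times> D))"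
    by (simp add: real_sqrt_mult power2_eq_square)
  finally show ?thesis by simp
qed

text \<open>Each indicator is split into a type function and a part in \<open>E0\<close>. Invariance
  of \<open>E0\<close> kills the mixed terms, the type functions give the main term, and
  \<open>walk_op_bound\<close> controls the rest.\<close>

lemma pyramids_spectral:
  assumes mu: "mu0 < 2 * real h" "mu1 < real k"
  defines "e1 \<equiv> real (card (E \<inter> A \<times> B))" and "e2 \<equiv> real (card (E \<inter> C \<times> D))"
  shows "\<bar>card (pyramids A B C D) - 3 * (real k)\<^sup>2 * e1 * e2 / (h * card V)\<bar> \<le> err * sqrt (e1 * e2)"
proof -
  \<comment> \<open>The number of arcs of each type.\<close>
  define N where "N = real h * card V / 3"
  have N: "N > 0" using h_pos fin_V V_ne by (auto simp: N_def card_gt_0_iff)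
  have ipty: "ip E (type_ind i) (type_ind j) = (if i = j then N else 0)" if "i < 3" for i j
  proof (cases "i = j")
    case True
    then show ?thesis using ip_ty_self[of i] card_block[OF that] by (simp add: N_def)
  next
    case False
    then show ?thesis by (auto simp: ip_def type_ind_def intro!: sum.neutral)
  qed
  define s t where "s = - e1 / N" and "t = - e2 / N"
  define f where "f = (\<lambda>e. ind A B e + s * type_ind 0 e)"
  define g where "g = (\<lambda>e. ind C D e + t * type_ind 2 e)"
  have fg_supp: "f \<in> supp_in E" "g \<in> supp_in E"
    by (auto simp: f_def g_def supp_in_def ind_def type_ind_def)
  have "ip E f (type_ind j) = 0" "ip E g (type_ind j) = 0" for j
    unfolding f_def g_def ip_linear ip_ind_ty[OF A] ip_ind_ty[OF C]
    using N by (auto simp: ipty s_def t_def e1_def e2_def)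
  then have fg: "f \<in> E0" "g \<in> E0" using fg_supp by (auto simp: E0_def orth_in_def)
  have one: "ip E one_E (type_ind 2) = N" unfolding one_E_eq ip_linear by (simp add: ipty)
  have orth: "ip E (walk_op z) (type_ind i) = 0" if "z \<in> E0" "i < 3" for z i
    using E0_walk_op[OF that(1)] that(2) by (simp add: E0_def orth_in_def)
  have "ip E (walk_op (ind A B)) (ind C D) = ip E (walk_op (\<lambda>e. f e + (- s) * type_ind 0 e)) (\<lambda>e. g e + (- t) * type_ind 2 e)"
    by (simp add: f_def g_def)
  also have "\<dots> = ip E (walk_op f) g + (- s) * ip E (walk_op g) (type_ind 0) + s * t * ip E (walk_op (type_ind 0)) (type_ind 2)"
    unfolding walk_op_add walk_op_scale ip_linear
    using orth[OF fg(1), of 2] by (simp add: walk_op_sym[of "type_ind 0" g] ip_commute[of E "type_ind 0"] algebra_simps)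
  also have "\<dots> = ip E (walk_op f) g + s * t * ((real k)\<^sup>2 * N)"
    using orth[OF fg(2), of 0] one by (simp add: walk_op_ty ip_linear ipty)
  also have "s * t * ((real k)\<^sup>2 * N) = 3 * (real k)\<^sup>2 * e1 * e2 / (h * card V)"
  proof -
    have "s * t * ((real k)\<^sup>2 * N) = (real k)\<^sup>2 * e1 * e2 / N" using N by (simp add: s_def t_def field_simps)
    then show ?thesis by (simp add: N_def)
  qed
  \<comment> \<open>For these indicators the last two terms of \<open>walk_op\<close> pair to zero,
    so only the pyramid count remains.\<close>
  finally have "real (card (pyramids A B C D)) - 3 * (real k)\<^sup>2 * e1 * e2 / (h * card V) = ip E (walk_op f) g"
    by (simp add: ip_walk_op ip_tri_adj_ind ip_tri_adj_ind_ind ip_bd_ind)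
  moreover have "\<bar>ip E (walk_op f) g\<bar> \<le> err * (sqrt (ip E f f) * sqrt (ip E g g))"
    by (rule walk_op_bound[OF mu fg])
  moreover have "ip E f f \<le> e1" "ip E g g \<le> e2"
    unfolding f_def g_def ip_linear ip_commute[of E "type_ind _" "ind _ _"] ip_ind_ty[OF A] ip_ind_ty[OF C] ip_ind_self
    using N by (simp_all add: ipty s_def t_def e1_def[symmetric] e2_def[symmetric] field_simps)
  then have "err * (sqrt (ip E f f) * sqrt (ip E g g)) \<le> err * (sqrt e1 * sqrt e2)"
    using ip_self_nonneg mu0_nonneg mu1_nonneg
    by (intro mult_left_mono mult_mono) (auto simp: err_def e1_def)
  ultimately show ?thesis by (simp add: real_sqrt_mult)
qed

theorem pyramids_estimate:
  defines "a \<equiv> real (card A)" and "b \<equiv> real (card B)" and "c \<equiv> real (card C)" and "d \<equiv> real (card D)"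
    and "n \<equiv> real (card V)"
  shows "\<bar>card (pyramids A B C D) - 27 * (2 * real h) * (real k)\<^sup>2 * a * b * c * d / (2 * n ^ 3)\<bar>
    \<le> 6 * mu0 * (real k)\<^sup>2 * sqrt (a * b * c * d) / (2 * real h * n)
        * (3 * (2 * real h) * (sqrt (a * b) + sqrt (c * d)) / (2 * n) + mu0)
      + err * root 4 (a * b * c * d)
        * sqrt ((3 * (2 * real h) * sqrt (a * b) / (2 * n) + mu0) * (3 * (2 * real h) * sqrt (c * d) / (2 * n) + mu0))"
proof (rule final_estimate[where ?e1.0 = "real (card (E \<inter> A \<times> B))" and ?e2.0 = "real (card (E \<inter> C \<times> D))"])
  have card_le: "real (card Z) \<le> card V / 3" if "Z \<subseteq> block i" "i < 3" for Z i
    using card_mono[OF fin_block that(1)] card_block[OF that(2)] by simp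
  show "a \<le> n / 3" "b \<le> n / 3" "c \<le> n / 3" "d \<le> n / 3"
    using card_le[OF A] card_le[OF B] card_le[OF C] card_le[OF D]
    by (auto simp: a_def b_def c_def d_def n_def)
  show "\<bar>real (card (E \<inter> A \<times> B)) - 3 * real h * a * b / n\<bar> \<le> mu0 * sqrt (a * b)"
    using mixing[OF A, of B] B by (simp add: a_def b_def n_def)
  \<comment> \<open>Here the colours wrap around: block 2 is followed by block 0.\<close>
  show "\<bar>real (card (E \<inter> C \<times> D)) - 3 * real h * c * d / n\<bar> \<le> mu0 * sqrt (c * d)"
    using mixing[OF C, of D] D by (simp add: c_def d_def n_def)
  show "real (card (pyramids A B C D)) \<le> (real k)\<^sup>2 * sqrt (real (card (E \<inter> A \<times> B)) * real (card (E \<inter> C \<times> D)))"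
    using pyramids_le by simp
  assume err: "err < (real k)\<^sup>2"
  \<comment> \<open>Both summands of \<open>err\<close> are nonnegative, so each is below
    \<open>k^2\<close>; the first yields \<open>mu0 < h\<close>, the second
    \<open>mu1 < k\<close>.\<close>
  have "(real k)\<^sup>2 * mu0 / h < (real k)\<^sup>2 * 1"
    using err mu1_nonneg unfolding err_def
    by (smt (verit) mult_nonneg_nonneg of_nat_0_le_iff)
  then have "(real k)\<^sup>2 * (mu0 / h) < (real k)\<^sup>2 * 1" by simp
  then have "mu0 / h < 1" using k_pos by (simp only: mult_less_cancel_left_pos zero_less_power of_nat_0_less_iff)
  then have m0: "mu0 < 2 * real h" using h_pos by (simp add: field_simps)
  have m1: "mu1 < real k"
  proof (rule ccontr)
    assume "\<not> mu1 < real k"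
    then have "real k * real k \<le> (real k + mu1) * mu1"
      using mu1_nonneg by (intro mult_mono) auto
    moreover have "(real k)\<^sup>2 * mu0 / h \<ge> 0" using mu0_nonneg by simp
    ultimately show False using err unfolding err_def power2_eq_square by linarith
  qed
  show "\<bar>real (card (pyramids A B C D)) - 3 * (real k)\<^sup>2 * real (card (E \<inter> A \<times> B)) * real (card (E \<inter> C \<times> D)) / (real h * n)\<bar>
      \<le> err * sqrt (real (card (E \<inter> A \<times> B)) * real (card (E \<inter> C \<times> D)))"
    using pyramids_spectral[OF m0 m1] by (simp add: n_def)
qed (use mu0_nonneg mu1_nonneg h_pos fin_V V_ne in
    \<open>auto simp: a_def b_def c_def d_def n_def err_def card_gt_0_iff\<close>)

end

end

section \<open>Tripartite regular triangle complexes\<close>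

locale tripartite_complex =
  fixes X :: "'v set set" and P1 P2 P3 :: "'v set" and k0 k1 :: nat
  assumes cx: "triangle_complex X"
    and tri: "tripartition X P1 P2 P3"
    and reg0: "\<forall>v\<in>cverts X. vdeg X v = k0"
    and reg1: "\<forall>e\<in>cedges X. edeg X e = k1"
begin

text \<open>Colour 2 is also the default for points that are not vertices, so the values stay below
  3 everywhere.\<close>

definition colour :: "'v \<Rightarrow> nat" where
  "colour v = (if v \<in> P1 then 0 else if v \<in> P2 then 1 else 2)"

definition arcs :: "('v \<times> 'v) set" where
  "arcs = {(u, w). {u, w} \<in> cedges X \<and> colour w = Suc (colour u) mod 3}"

definition cycles :: "('v \<times> 'v \<times> 'v) set" where
  "cycles = {(u, w, z). {u, w, z} \<in> ctris X \<and> colour w = Suc (colour u) mod 3 \<and>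
     colour z = Suc (colour w) mod 3}"

section \<open>Edges, triangles and their cyclic orientation\<close>

lemma face: "\<sigma> \<in> X \<Longrightarrow> \<tau> \<subseteq> \<sigma> \<Longrightarrow> \<tau> \<noteq> {} \<Longrightarrow> \<tau> \<in> X"
  using cx unfolding triangle_complex_def by blast

lemma fin_X: "finite X"
  using cx unfolding triangle_complex_def by blast

lemma vert: "\<sigma> \<in> X \<Longrightarrow> v \<in> \<sigma> \<Longrightarrow> v \<in> cverts X"
  using face[of \<sigma> "{v}"] by (simp add: cverts_def)

lemma fin_verts: "finite (cverts X)"
proof -
  have "inj_on (\<lambda>v. {v}) (cverts X)" "(\<lambda>v. {v}) ` cverts X \<subseteq> X"
    by (auto simp: cverts_def)
  then show ?thesis using fin_X by (metis finite_imageD finite_subset)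
qed

lemma colour_less: "colour v < 3"
  by (simp add: colour_def)

lemma colour_cases: "colour v = 0 \<or> colour v = 1 \<or> colour v = 2"
  by (simp add: colour_def)

lemma colour_iff: "v \<in> cverts X \<Longrightarrow> colour v = 0 \<longleftrightarrow> v \<in> P1" "v \<in> cverts X \<Longrightarrow> colour v = 1 \<longleftrightarrow> v \<in> P2"
  "v \<in> cverts X \<Longrightarrow> colour v = 2 \<longleftrightarrow> v \<in> P3"
  using tri by (auto simp: colour_def tripartition_def)

lemma colour_inj:
  assumes t: "t \<in> ctris X" and uw: "u \<in> t" "w \<in> t" "colour u = colour w"
  shows "u = w"
proof -
  have card: "card (t \<inter> P1) = 1" "card (t \<inter> P2) = 1" "card (t \<inter> P3) = 1"
    using tri t by (auto simp: tripartition_def)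
  have V: "u \<in> cverts X" "w \<in> cverts X" using t uw vert by (auto simp: ctris_def)
  consider "u \<in> P1" | "u \<in> P2" | "u \<in> P3" using tri V(1) by (auto simp: tripartition_def)
  then show ?thesis
  proof cases
    case 1
    then have "u \<in> t \<inter> P1" "w \<in> t \<inter> P1"
      using uw colour_iff(1)[OF V(1)] colour_iff(1)[OF V(2)] by auto
    then show ?thesis using card(1) by (metis card_1_singletonE singletonD)
  next
    case 2
    then have "u \<in> t \<inter> P2" "w \<in> t \<inter> P2"
      using uw colour_iff(2)[OF V(1)] colour_iff(2)[OF V(2)] by auto
    then show ?thesis using card(2) by (metis card_1_singletonE singletonD)
  next
    case 3
    then have "u \<in> t \<inter> P3" "w \<in> t \<inter> P3"
      using uw colour_iff(3)[OF V(1)] colour_iff(3)[OF V(2)] by auto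
    then show ?thesis using card(3) by (metis card_1_singletonE singletonD)
  qed
qed

lemma tri_third:
  assumes t: "t \<in> ctris X" and uw: "u \<in> t" "w \<in> t" "u \<noteq> w"
  obtains z where "t = {u, w, z}" "z \<noteq> u" "z \<noteq> w"
proof -
  have "card t = 3" using t by (simp add: ctris_def)
  then have "finite t" using card.infinite by fastforce
  then have "card (t - {u, w}) = 1"
    using \<open>card t = 3\<close> uw by (subst card_Diff_subset) auto
  then obtain z where "t - {u, w} = {z}" by (rule card_1_singletonE)
  then have "t = {u, w, z}" "z \<noteq> u" "z \<noteq> w" using uw by auto
  then show thesis using that by blast
qed

lemma edge_in_tri: "t \<in> ctris X \<Longrightarrow> u \<in> t \<Longrightarrow> w \<in> t \<Longrightarrow> u \<noteq> w \<Longrightarrow> {u, w} \<in> cedges X"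
  using face[of t "{u, w}"] by (auto simp: ctris_def cedges_def)

text \<open>Some triangle exists and all edge degrees agree, so every edge lies in a triangle. This
  passes tripartiteness, which is stated for triangles, on to edges.\<close>

lemma k1_pos: "k1 > 0"
proof -
  obtain t where t: "t \<in> ctris X" using cx by (auto simp: triangle_complex_def ctris_def)
  then have "card t = 3" by (simp add: ctris_def)
  then obtain u w z where "t = {u, w, z}" "u \<noteq> w" by (auto simp: card_3_iff)
  then have e: "{u, w} \<in> cedges X" and sub: "{u, w} \<subseteq> t" using t edge_in_tri by auto
  have "finite {t \<in> ctris X. {u, w} \<subseteq> t}" using fin_X by (simp add: ctris_def)
  then have "edeg X {u, w} > 0" unfolding edeg_def using t sub by (auto simp: card_gt_0_iff)
  then show ?thesis using reg1 e by simp
qed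

lemma edge_tri:
  assumes "e \<in> cedges X"
  obtains t where "t \<in> ctris X" "e \<subseteq> t"
proof -
  have "card {t \<in> ctris X. e \<subseteq> t} > 0" using reg1 assms k1_pos by (simp add: edeg_def)
  then have "{t \<in> ctris X. e \<subseteq> t} \<noteq> {}" by (metis card.empty less_irrefl)
  then show thesis using that by blast
qed

lemma k0_pos: "k0 > 0"
proof -
  obtain t where t: "t \<in> ctris X" using cx by (auto simp: triangle_complex_def ctris_def)
  then have "card t = 3" by (simp add: ctris_def)
  then obtain u w z where t3: "t = {u, w, z}" "u \<noteq> w" by (auto simp: card_3_iff)
  then have e: "{u, w} \<in> cedges X" using t edge_in_tri by auto
  have "finite {e \<in> cedges X. u \<in> e}" using fin_X by (simp add: cedges_def)
  then have "vdeg X u > 0" unfolding vdeg_def using e by (auto simp: card_gt_0_iff)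
  moreover have "u \<in> cverts X" using t t3 vert by (auto simp: ctris_def)
  ultimately show ?thesis using reg0 by simp
qed

lemma edge_colour: "{u, w} \<in> cedges X \<Longrightarrow> u \<noteq> w \<and> colour u \<noteq> colour w"
proof -
  assume e: "{u, w} \<in> cedges X"
  then have ne: "u \<noteq> w" by (auto simp: cedges_def)
  obtain t where "t \<in> ctris X" "{u, w} \<subseteq> t" using edge_tri[OF e] .
  then show ?thesis using colour_inj ne by blast
qed

lemma arc_cases: "{u, w} \<in> cedges X \<Longrightarrow> (u, w) \<in> arcs \<or> (w, u) \<in> arcs"
  using edge_colour[of u w] colour_cases[of u] colour_cases[of w]
  by (auto simp: arcs_def insert_commute)

lemma cycles_rot: "(u, w, z) \<in> cycles \<Longrightarrow> (w, z, u) \<in> cycles"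
proof -
  assume c: "(u, w, z) \<in> cycles"
  have "{w, z, u} = {u, w, z}" by auto
  then show ?thesis using c colour_cases[of u] by (auto simp: cycles_def)
qed

lemma cycles_arc: "(u, w, z) \<in> cycles \<Longrightarrow> (u, w) \<in> arcs"
proof -
  assume c: "(u, w, z) \<in> cycles"
  then have "colour u \<noteq> colour w" using colour_cases[of u] by (auto simp: cycles_def)
  then have "u \<noteq> w" by auto
  then show ?thesis using c edge_in_tri[of "{u, w, z}" u w] by (auto simp: cycles_def arcs_def)
qed

lemma cycles_iff:
  assumes "(u, w) \<in> arcs"
  shows "(u, w, z) \<in> cycles \<longleftrightarrow> distinct [u, w, z] \<and> {u, w, z} \<in> X"
proof
  assume c: "(u, w, z) \<in> cycles"
  then have t: "{u, w, z} \<in> X" "card {u, w, z} = 3" by (auto simp: cycles_def ctris_def)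
  then show "distinct [u, w, z] \<and> {u, w, z} \<in> X"
    by (auto simp: card_insert_if split: if_splits)
next
  assume d: "distinct [u, w, z] \<and> {u, w, z} \<in> X"
  then have t: "{u, w, z} \<in> ctris X" by (auto simp: ctris_def)
  have "colour z \<noteq> colour u" "colour z \<noteq> colour w" using colour_inj[OF t] d by fastforce+
  then show "(u, w, z) \<in> cycles"
    using assms t colour_cases[of u] colour_cases[of z] by (auto simp: cycles_def arcs_def)
qed

lemma card_thirds:
  assumes a: "(u, w) \<in> arcs"
  shows "card {z. (u, w, z) \<in> cycles} = k1"
proof -
  have e: "{u, w} \<in> cedges X" and ne: "u \<noteq> w" using a edge_colour by (auto simp: arcs_def)
  have "bij_betw (\<lambda>z. {u, w, z}) {z. (u, w, z) \<in> cycles} {t \<in> ctris X. {u, w} \<subseteq> t}"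
    unfolding bij_betw_def
  proof
    show "inj_on (\<lambda>z. {u, w, z}) {z. (u, w, z) \<in> cycles}"
      by (auto simp: inj_on_def cycles_iff[OF a])
    show "(\<lambda>z. {u, w, z}) ` {z. (u, w, z) \<in> cycles} = {t \<in> ctris X. {u, w} \<subseteq> t}"
    proof (intro equalityI subsetI)
      fix t assume "t \<in> {t \<in> ctris X. {u, w} \<subseteq> t}"
      then have t: "t \<in> ctris X" "u \<in> t" "w \<in> t" by auto
      then obtain z where "t = {u, w, z}" "z \<noteq> u" "z \<noteq> w" using tri_third ne by metis
      moreover have "t \<in> X" using t by (simp add: ctris_def)
      ultimately show "t \<in> (\<lambda>z. {u, w, z}) ` {z. (u, w, z) \<in> cycles}"
        using ne by (auto simp: cycles_iff[OF a])
    qed (auto simp: cycles_def)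
  qed
  then have "card {z. (u, w, z) \<in> cycles} = edeg X {u, w}"
    unfolding edeg_def by (rule bij_betw_same_card)
  then show ?thesis using reg1 e by simp
qed

section \<open>Neighbourhoods and vertex degrees\<close>

lemma nbrs_eq: "{u. u \<noteq> v \<and> {u, v} \<in> X} = {u. (u, v) \<in> arcs} \<union> {w. (v, w) \<in> arcs}"
proof -
  have "u \<noteq> v \<and> {u, v} \<in> X \<longleftrightarrow> {u, v} \<in> cedges X" for u
    by (auto simp: cedges_def card_insert_if split: if_splits)
  then show ?thesis
    using arc_cases by (auto simp: arcs_def insert_commute)
qed

lemma arcs_asym: "(u, w) \<in> arcs \<Longrightarrow> (w, u) \<notin> arcs"
  using colour_cases[of u] by (auto simp: arcs_def)

lemma arcs_verts: "arcs \<subseteq> cverts X \<times> cverts X"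
  using vert by (auto simp: arcs_def cedges_def)

lemma fin_arcs: "finite {u. (u, v) \<in> arcs}" "finite {w. (v, w) \<in> arcs}"
  using arcs_verts by (auto intro: finite_subset[OF _ fin_verts])

lemma card_arcs:
  assumes v: "v \<in> cverts X"
  shows "card {u. (u, v) \<in> arcs} + card {w. (v, w) \<in> arcs} = k0"
proof -
  have "bij_betw (\<lambda>u. {u, v}) {u. u \<noteq> v \<and> {u, v} \<in> X} {e \<in> cedges X. v \<in> e}"
    unfolding bij_betw_def
  proof
    show "inj_on (\<lambda>u. {u, v}) {u. u \<noteq> v \<and> {u, v} \<in> X}"
      by (auto simp: inj_on_def doubleton_eq_iff)
    show "(\<lambda>u. {u, v}) ` {u. u \<noteq> v \<and> {u, v} \<in> X} = {e \<in> cedges X. v \<in> e}"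
    proof (intro equalityI subsetI)
      fix e assume "e \<in> {e \<in> cedges X. v \<in> e}"
      then have e: "e \<in> X" "card e = 2" "v \<in> e" by (auto simp: cedges_def)
      then obtain a b where "e = {a, b}" "a \<noteq> b" by (auto simp: card_2_iff)
      then show "e \<in> (\<lambda>u. {u, v}) ` {u. u \<noteq> v \<and> {u, v} \<in> X}"
        using e by (auto simp: insert_commute)
    qed (auto simp: cedges_def)
  qed
  then have "card {u. u \<noteq> v \<and> {u, v} \<in> X} = vdeg X v"
    unfolding vdeg_def by (rule bij_betw_same_card)
  then have "card {u. u \<noteq> v \<and> {u, v} \<in> X} = k0"
    using reg0 v by simp
  then show ?thesis
    unfolding nbrs_eq using arcs_asym by (subst (asm) card_Un_disjoint) (auto simp: fin_arcs)
qed

text \<open>The link of \<open>v\<close> is a bipartite graph between out- and in-neighbours,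
  regular of degree \<open>k1\<close>, so its two sides have equal size.\<close>

lemma card_in_out: "card {u. (u, v) \<in> arcs} = card {w. (v, w) \<in> arcs}"
proof -
  have "(\<Sum>w\<in>{w. (v, w) \<in> arcs}. card {z. (v, w, z) \<in> cycles})
      = card (Sigma {w. (v, w) \<in> arcs} (\<lambda>w. {z. (v, w, z) \<in> cycles}))"
    using fin_arcs card_thirds k1_pos
    by (intro card_SigmaI[symmetric]) (auto intro: card_ge_0_finite)
  also have "\<dots> = card (Sigma {u. (u, v) \<in> arcs} (\<lambda>u. {z. (u, v, z) \<in> cycles}))"
  proof (rule bij_betw_same_card)
    show "bij_betw (\<lambda>(w, z). (z, w)) (Sigma {w. (v, w) \<in> arcs} (\<lambda>w. {z. (v, w, z) \<in> cycles}))
        (Sigma {u. (u, v) \<in> arcs} (\<lambda>u. {z. (u, v, z) \<in> cycles}))"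
      by (rule bij_betw_byWitness[of _ "\<lambda>(w, z). (z, w)"])
        (auto dest: cycles_rot intro: cycles_rot cycles_arc)
  qed
  also have "\<dots> = (\<Sum>u\<in>{u. (u, v) \<in> arcs}. card {z. (u, v, z) \<in> cycles})"
    using fin_arcs card_thirds k1_pos
    by (intro card_SigmaI) (auto intro: card_ge_0_finite)
  finally have "k1 * card {w. (v, w) \<in> arcs} = k1 * card {u. (u, v) \<in> arcs}"
    by (simp add: card_thirds)
  then show ?thesis using k1_pos by simp
qed

lemma verts_nonempty: "cverts X \<noteq> {}"
proof -
  obtain t where "t \<in> X" "t \<noteq> {}" using cx by (auto simp: triangle_complex_def)
  then show ?thesis using vert by blast
qed

lemma k0_eq: "k0 = 2 * (k0 div 2)"
proof -
  obtain v where "v \<in> cverts X" using verts_nonempty by blast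
  then show ?thesis using card_arcs[of v] card_in_out[of v] by presburger
qed

sublocale cyclic_triangles "cverts X" arcs cycles colour "k0 div 2" k1
proof
  show "finite (cverts X)" "cverts X \<noteq> {}" "arcs \<subseteq> cverts X \<times> cverts X"
    by (rule fin_verts verts_nonempty arcs_verts)+
  show "colour v < 3" for v by (rule colour_less)
  show "colour w = Suc (colour u) mod 3" if "(u, w) \<in> arcs" for u w
    using that by (simp add: arcs_def)
  show "(u, w) \<in> arcs" "(w, z, u) \<in> cycles" if "(u, w, z) \<in> cycles" for u w z
    using that by (rule cycles_arc cycles_rot)+
  show "card {z. (u, w, z) \<in> cycles} = k1" if "(u, w) \<in> arcs" for u w
    using that by (rule card_thirds)
  show "card {w. (v, w) \<in> arcs} = k0 div 2" "card {u. (u, v) \<in> arcs} = k0 div 2"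
    if "v \<in> cverts X" for v
    using card_arcs[OF that] card_in_out[of v] by simp_all
  show "0 < k0 div 2" "0 < k1" using k0_pos k0_eq k1_pos by linarith+
qed

text \<open>Real eigenfunctions are complex ones, which carries the spectral hypothesis over;
  reversing an arc does not affect the graph Laplacian.\<close>

lemma spec_Z0_real:
  assumes g: "g \<in> supp_in (cverts X)" "g \<noteq> (\<lambda>_. 0)" "(\<Sum>v\<in>cverts X. g v) = 0"
    and eig: "bd (cob g) = (\<lambda>v. ev * g v)"
  shows "complex_of_real ev \<in> spec_Z0 X"
proof -
  define f where "f = (\<lambda>v. complex_of_real (g v))"
  have "f \<in> Omega0 X" using g(1) by (simp add: f_def Omega0_def supp_in_def cverts_def)
  moreover have "bd0 X f = 0" using g(3) by (simp add: f_def bd0_def flip: of_real_sum)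
  moreover have "f \<noteq> (\<lambda>_. 0)" using g(2) by (auto simp: f_def fun_eq_iff)
  moreover have "uLap0 X f v = complex_of_real ev * f v" for v
  proof -
    have "uLap0 X f v = (\<Sum>u\<in>{u. u \<noteq> v \<and> {u, v} \<in> X}. complex_of_real (g v - g u))"
      unfolding uLap0_def bd1_def by (intro sum.cong) (auto simp: cbd1_def f_def)
    also have "\<dots> = (\<Sum>u\<in>inn v. complex_of_real (g v - g u)) + (\<Sum>w\<in>out v. complex_of_real (g v - g w))"
      unfolding nbrs_eq inn_def out_def
      using arcs_asym by (intro sum.union_disjoint) (auto simp: fin_arcs)
    also have "\<dots> = complex_of_real ((\<Sum>u\<in>inn v. g v - g u) - (\<Sum>w\<in>out v. g w - g v))"
      by (simp add: sum_subtractf algebra_simps)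
    also have "(\<Sum>u\<in>inn v. g v - g u) - (\<Sum>w\<in>out v. g w - g v) = bd (cob g) v"
      unfolding bd_def by (intro arg_cong2[of _ _ _ _ minus] sum.cong) (auto simp: cob_def inn_def out_def)
    finally show ?thesis by (simp add: eig f_def)
  qed
  then have "uLap0 X f = (\<lambda>v. complex_of_real ev * f v)" by blast
  ultimately show ?thesis unfolding spec_Z0_def by blast
qed

text \<open>A function on arcs extends to a skew form \<open>r\<close>. In the Laplacian the edge
  itself contributes once per triangle, which accounts for the shift by \<open>k1\<close>.\<close>

lemma spec_Z1_real:
  assumes x: "x \<in> supp_in arcs" "x \<noteq> (\<lambda>_. 0)" "bd x = (\<lambda>_. 0)"
    and eig: "tri_adj x = (\<lambda>e. m * x e)"
  shows "complex_of_real (real k1 + m) \<in> spec_Z1 X"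
proof -
  define r where "r = (\<lambda>u w. x (u, w) - x (w, u))"
  define f where "f = (\<lambda>u w. complex_of_real (r u w))"
  have x0: "x (u, w) = 0" if "(u, w) \<notin> arcs" for u w
    using x(1) that by (auto simp: supp_in_def)
  have rev0: "x (w, u) = 0" if "(u, w) \<in> arcs" for u w
    using x0 arcs_asym that by blast
  have arc_X: "u \<noteq> w \<and> {u, w} \<in> X" if "(u, w) \<in> arcs" for u w
    using that edge_colour by (auto simp: arcs_def cedges_def)
  have skew: "r w u = - r u w" for u w by (simp add: r_def)
  have r0: "r u w = 0" if "\<not> (u \<noteq> w \<and> {u, w} \<in> X)" for u w
  proof -
    have "{w, u} = {u, w}" by auto
    then have "(u, w) \<notin> arcs" "(w, u) \<notin> arcs" using that arc_X[of u w] arc_X[of w u] by auto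
    then show ?thesis by (simp add: r_def x0)
  qed
  have "f \<in> Omega1 X"
    unfolding Omega1_def mem_Collect_eq
  proof (intro conjI allI impI)
    show "f u w = 0" if "\<not> (u \<noteq> w \<and> {u, w} \<in> X)" for u w
      using r0[OF that] by (simp add: f_def)
    show "f w u = - f u w" for u w by (simp add: f_def r_def)
  qed
  moreover have "bd1 X f = (\<lambda>_. 0)"
  proof
    fix v
    have "bd1 X f v = (\<Sum>u\<in>inn v. f u v) + (\<Sum>w\<in>out v. f w v)"
      unfolding bd1_def nbrs_eq inn_def out_def
      using arcs_asym by (intro sum.union_disjoint) (auto simp: fin_arcs)
    also have "(\<Sum>u\<in>inn v. f u v) = (\<Sum>u\<in>inn v. complex_of_real (x (u, v)))"
      by (intro sum.cong) (auto simp: f_def r_def inn_def rev0)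
    also have "(\<Sum>w\<in>out v. f w v) = (\<Sum>w\<in>out v. - complex_of_real (x (v, w)))"
      by (intro sum.cong) (auto simp: f_def r_def out_def rev0)
    finally have "bd1 X f v = complex_of_real (bd x v)"
      by (simp add: bd_def sum_negf)
    then show "bd1 X f v = 0" by (simp add: x(3))
  qed
  moreover have "f \<noteq> (\<lambda>_ _. 0)"
  proof -
    obtain e where "x e \<noteq> 0" using x(2) by (meson ext)
    then obtain u w where uw: "x (u, w) \<noteq> 0" by (cases e) auto
    then have "x (w, u) = 0" using x0 arcs_asym by blast
    then have "f u w \<noteq> 0" using uw by (simp add: f_def r_def)
    then show ?thesis by (auto simp: fun_eq_iff)
  qed
  moreover have "uLap1 X f u w = complex_of_real (real k1 + m) * f u w" for u w
  proof -
    have lap: "uLap1 X f u w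
        = complex_of_real (\<Sum>z\<in>{z. distinct [z, u, w] \<and> {z, u, w} \<in> X}. r u w - r z w + r z u)" for u w
      unfolding uLap1_def bd2_def of_real_sum by (intro sum.cong) (auto simp: cbd2_def f_def)
    have arc: "uLap1 X f u w = complex_of_real (real k1 + m) * f u w" if a: "(u, w) \<in> arcs" for u w
    proof -
      have "{z, u, w} = {u, w, z}" for z by auto
      then have "{z. distinct [z, u, w] \<and> {z, u, w} \<in> X} = third u w"
        using cycles_iff[OF a] by (auto simp: third_def)
      then have "uLap1 X f u w = complex_of_real (\<Sum>z\<in>third u w. r u w - r z w + r z u)"
        by (simp only: lap)
      also have "(\<Sum>z\<in>third u w. r u w - r z w + r z u)
          = (\<Sum>z\<in>third u w. x (u, w) + (x (w, z) + x (z, u)))"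
      proof (intro sum.cong refl)
        fix z assume "z \<in> third u w"
        then have "(u, w, z) \<in> cycles" by (simp add: third_def)
        then have "(w, u) \<notin> arcs" "(z, w) \<notin> arcs" "(u, z) \<notin> arcs"
          using T_edges arcs_asym by blast+
        then show "r u w - r z w + r z u = x (u, w) + (x (w, z) + x (z, u))"
          by (simp add: r_def x0)
      qed
      also have "\<dots> = real k1 * x (u, w) + tri_adj x (u, w)"
        using card_nbrs(1)[OF a] by (simp add: sum.distrib tri_adj_def)
      also have "\<dots> = (real k1 + m) * r u w"
        using x0[OF arcs_asym[OF a]] by (simp add: eig r_def algebra_simps)
      finally show ?thesis by (simp add: f_def)
    qed
    \<comment> \<open>Skewness reduces reversed arcs to arcs; pairs that are not edges lie in no
      triangle.\<close>
    have skew_lap: "uLap1 X f w u = - uLap1 X f u w"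
    proof -
      have "{z. distinct [z, w, u] \<and> {z, w, u} \<in> X} = {z. distinct [z, u, w] \<and> {z, u, w} \<in> X}"
        by (auto simp: insert_commute)
      moreover have "r w u - r z u + r z w = - (r u w - r z w + r z u)" for z
        using skew[of w u] by simp
      ultimately show ?thesis
        unfolding lap by (simp only: sum_negf of_real_minus)
    qed
    consider "(u, w) \<in> arcs" | "(w, u) \<in> arcs" | "(u, w) \<notin> arcs" "(w, u) \<notin> arcs" by blast
    then show ?thesis
    proof cases
      case 1
      then show ?thesis by (rule arc)
    next
      case 2
      then show ?thesis using arc[OF 2] skew_lap skew[of w u] by (simp add: f_def)
    next
      case 3
      then have "{z. distinct [z, u, w] \<and> {z, u, w} \<in> X} = {}"
        using arc_cases[of u w] face[of "{z, u, w}" "{u, w}" for z] by (auto simp: cedges_def)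
      then have "uLap1 X f u w = 0" unfolding lap by (simp only: sum.empty of_real_0)
      then show ?thesis using 3 by (simp add: f_def r_def x0)
    qed
  qed
  then have "uLap1 X f = (\<lambda>u w. complex_of_real (real k1 + m) * f u w)" by blast
  ultimately show ?thesis unfolding spec_Z1_def by blast
qed

text \<open>The sets are disjoint where their roles could be confused, so a pair of triangles
  determines its four named vertices.\<close>

lemma card_F2:
  assumes A: "A \<subseteq> P1" "A \<subseteq> cverts X" and B: "B \<subseteq> P2" "B \<subseteq> cverts X"
    and C: "C \<subseteq> P3" "C \<subseteq> cverts X" and D: "D \<subseteq> P1" "D \<subseteq> cverts X" and AD: "A \<inter> D = {}"
  shows "card (F2 X A B C D) = card {(a, b, c, d). a \<in> A \<and> b \<in> B \<and> c \<in> C \<and> d \<in> D \<and>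
    (a, b, c) \<in> cycles \<and> (d, b, c) \<in> cycles}" (is "_ = card ?Q")
proof -
  have disj: "A \<inter> B = {}" "A \<inter> C = {}" "B \<inter> C = {}" "D \<inter> B = {}" "D \<inter> C = {}"
    using A B C D tri by (auto simp: tripartition_def)
  have col: "\<And>v. v \<in> A \<Longrightarrow> colour v = 0" "\<And>v. v \<in> B \<Longrightarrow> colour v = 1" "\<And>v. v \<in> C \<Longrightarrow> colour v = 2"
    "\<And>v. v \<in> D \<Longrightarrow> colour v = 0"
    using A B C D colour_iff by blast+
  let ?f = "\<lambda>(a, b, c, d). ({a, b, c}, {d, b, c})"
  have tri_of: "\<exists>a b c. a \<in> A' \<and> b \<in> B \<and> c \<in> C \<and> t = {a, b, c}"
    if t: "t \<in> ctris X" "card (t \<inter> A') = 1" "card (t \<inter> B) = 1" "card (t \<inter> C) = 1"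
      and A': "A' = A \<or> A' = D" for t A'
  proof -
    obtain a b c where abc: "t \<inter> A' = {a}" "t \<inter> B = {b}" "t \<inter> C = {c}"
      using t by (metis card_1_singletonE)
    then have m: "a \<in> t" "a \<in> A'" "b \<in> t" "b \<in> B" "c \<in> t" "c \<in> C" by blast+
    then have ne: "a \<noteq> b" "a \<noteq> c" "b \<noteq> c" using disj A' by blast+
    then obtain z where z: "t = {a, b, z}" "z \<noteq> a" "z \<noteq> b" using tri_third[OF t(1) m(1,3)] by metis
    then have "c = z" using m ne by blast
    then show ?thesis using z m by blast
  qed
  have inj: "inj_on ?f ?Q"
  proof (rule inj_onI; clarsimp)
    fix a b c d a' b' c' d'
    assume m: "a \<in> A" "b \<in> B" "c \<in> C" "d \<in> D" "a' \<in> A" "b' \<in> B" "c' \<in> C" "d' \<in> D"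
      and e1: "{a, b, c} = {a', b', c'}" and e2: "{d, b, c} = {d', b', c'}"
    have "{a, b, c} \<inter> A = {a}" "{a', b', c'} \<inter> A = {a'}" "{a, b, c} \<inter> B = {b}" "{a', b', c'} \<inter> B = {b'}"
      "{a, b, c} \<inter> C = {c}" "{a', b', c'} \<inter> C = {c'}" "{d, b, c} \<inter> D = {d}" "{d', b', c'} \<inter> D = {d'}"
      using m disj by blast+
    then show "a = a' \<and> b = b' \<and> c = c' \<and> d = d'" using e1 e2 by (metis singleton_inject)
  qed
  have "?f ` ?Q = F2 X A B C D"
  proof (intro equalityI subsetI)
    fix p assume "p \<in> ?f ` ?Q"
    then obtain a b c d where p: "p = ({a, b, c}, {d, b, c})"
      and m: "a \<in> A" "b \<in> B" "c \<in> C" "d \<in> D" and cyc: "(a, b, c) \<in> cycles" "(d, b, c) \<in> cycles"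
      by auto
    have "{a, b, c} \<inter> A = {a}" "{a, b, c} \<inter> B = {b}" "{a, b, c} \<inter> C = {c}"
      "{d, b, c} \<inter> D = {d}" "{d, b, c} \<inter> B = {b}" "{d, b, c} \<inter> C = {c}"
      "{a, b, c} \<inter> {d, b, c} = {b, c}"
      using m disj AD by blast+
    moreover have "{a, b, c} \<in> ctris X" "{d, b, c} \<in> ctris X" using cyc by (auto simp: cycles_def)
    moreover have "{b, c} \<in> cedges X"
      using m disj by (intro edge_in_tri[OF \<open>{a, b, c} \<in> ctris X\<close>]) auto
    ultimately show "p \<in> F2 X A B C D" by (simp add: p F2_def)
  next
    fix p assume "p \<in> F2 X A B C D"
    then obtain t t' where p: "p = (t, t')" and t: "t \<in> ctris X" "t' \<in> ctris X"
      "card (t \<inter> A) = 1" "card (t \<inter> B) = 1" "card (t \<inter> C) = 1"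
      "card (t' \<inter> B) = 1" "card (t' \<inter> C) = 1" "card (t' \<inter> D) = 1" and e: "t \<inter> t' \<in> cedges X"
      by (auto simp: F2_def)
    obtain a b c where abc: "a \<in> A" "b \<in> B" "c \<in> C" "t = {a, b, c}"
      using tri_of[of t A] t by blast
    obtain d b' c' where dbc: "d \<in> D" "b' \<in> B" "c' \<in> C" "t' = {d, b', c'}"
      using tri_of[of t' D] t by blast
    \<comment> \<open>As \<open>A\<close> and \<open>D\<close> are disjoint, neither apex is shared;
      an intersection of size two must be the whole base of both triangles.\<close>
    have sub: "t \<inter> t' \<subseteq> {b, c}" "t \<inter> t' \<subseteq> {b', c'}"
      using abc dbc disj AD by blast+
    have "card (t \<inter> t') = 2" using e by (simp add: cedges_def)
    then have "t \<inter> t' = {b, c}" "t \<inter> t' = {b', c'}"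
      using card_seteq[OF _ sub(1)] card_seteq[OF _ sub(2)] by (simp_all add: card_insert_if)
    then have "b \<in> {b', c'}" "c \<in> {b', c'}" by auto
    then have "b = b'" "c = c'" using abc dbc disj by auto
    then have "(a, b, c, d) \<in> ?Q" "p = ?f (a, b, c, d)"
      using abc dbc t col p by (auto simp: cycles_def)
    then show "p \<in> ?f ` ?Q" by (rule rev_image_eqI)
  qed
  then show ?thesis using card_image[OF inj] by simp
qed

end

section \<open>Transfer of the pyramid estimate to the triangle complex\<close>

theorem theorem7p1:
  fixes X :: "'v set set" and P1 P2 P3 A B C D :: "'v set"
    and n k0 k1 :: nat and mu0 mu1 :: real
  assumes cx: "triangle_complex X"
    and tri: "tripartition X P1 P2 P3"
    and n_def: "n = card (cverts X)"
    and reg0: "\<forall>v\<in>cverts X. vdeg X v = k0"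
    and reg1: "\<forall>e\<in>cedges X. edeg X e = k1"
    and mu0: "mu0 \<ge> 0" and mu1: "mu1 \<ge> 0"
    and spec0: "spec_Z0 X \<subseteq> complex_of_real ` ({r. \<bar>r - real k0\<bar> \<le> mu0} \<union> {3 * real k0 / 2})"
    and spec1: "spec_Z1 X \<subseteq> complex_of_real ` ({r. \<bar>r - real k1\<bar> \<le> mu1} \<union>
                   {r. \<bar>r - 2 * real k1\<bar> \<le> mu1} \<union> {3 * real k1})"
    and sub: "A \<subseteq> cverts X" "B \<subseteq> cverts X" "C \<subseteq> cverts X" "D \<subseteq> cverts X"
    and disj: "A \<inter> B = {}" "A \<inter> C = {}" "A \<inter> D = {}" "B \<inter> C = {}" "B \<inter> D = {}" "C \<inter> D = {}"
    and blocks: "A \<union> D \<subseteq> P1" "B \<subseteq> P2" "C \<subseteq> P3"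
  shows "let a = real (card A); b = real (card B); c = real (card C); d = real (card D) in
     \<bar>real (card (F2 X A B C D)) - 27 * k0 * k1^2 * a * b * c * d / (2 * n^3)\<bar>
     \<le> 6 * mu0 * k1^2 * sqrt (a * b * c * d) / (k0 * n)
          * (3 * k0 * (sqrt (a * b) + sqrt (c * d)) / (2 * n) + mu0)
       + (2 * k1^2 * mu0 / k0 + (k1 + mu1) * mu1) * root 4 (a * b * c * d)
          * sqrt ((3 * k0 * sqrt (a * b) / (2 * n) + mu0) * (3 * k0 * sqrt (c * d) / (2 * n) + mu0))"
proof -
  interpret tripartite_complex X P1 P2 P3 k0 k1
    by unfold_locales (fact cx tri reg0 reg1)+
  define h where "h = k0 div 2"
  have k0: "real k0 = 2 * real h" using k0_eq unfolding h_def by (metis of_nat_mult of_nat_numeral)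
  interpret spectral_triangles "cverts X" arcs cycles colour "k0 div 2" k1 mu0 mu1
  proof
    show "mu0 \<ge> 0" "mu1 \<ge> 0" by (fact mu0 mu1)+
  next
    fix g ev
    assume "g \<in> supp_in (cverts X)" "g \<noteq> (\<lambda>_. 0)" "(\<Sum>v\<in>cverts X. g v) = 0" "bd (cob g) = (\<lambda>v. ev * g v)"
    then have "complex_of_real ev \<in> spec_Z0 X" by (rule spec_Z0_real)
    then have "complex_of_real ev \<in> complex_of_real ` ({r. \<bar>r - real k0\<bar> \<le> mu0} \<union> {3 * real k0 / 2})"
      using spec0 by blast
    then have "ev \<in> {r. \<bar>r - real k0\<bar> \<le> mu0} \<union> {3 * real k0 / 2}"
      by (simp only: inj_image_mem_iff[OF inj_of_real])
    then show "\<bar>ev - 2 * real (k0 div 2)\<bar> \<le> mu0 \<or> ev = 3 * real (k0 div 2)"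
      unfolding h_def[symmetric] k0 by auto
  next
    fix x m
    assume "x \<in> supp_in arcs" "x \<noteq> (\<lambda>_. 0)" "bd x = (\<lambda>_. 0)" "tri_adj x = (\<lambda>e. m * x e)"
    then have "complex_of_real (real k1 + m) \<in> spec_Z1 X" by (rule spec_Z1_real)
    then have "complex_of_real (real k1 + m) \<in> complex_of_real ` ({r. \<bar>r - real k1\<bar> \<le> mu1} \<union>
        {r. \<bar>r - 2 * real k1\<bar> \<le> mu1} \<union> {3 * real k1})"
      using spec1 by blast
    then have "real k1 + m \<in> {r. \<bar>r - real k1\<bar> \<le> mu1} \<union> {r. \<bar>r - 2 * real k1\<bar> \<le> mu1} \<union> {3 * real k1}"
      by (simp only: inj_image_mem_iff[OF inj_of_real])
    then show "\<bar>m\<bar> \<le> mu1 \<or> \<bar>m - real k1\<bar> \<le> mu1 \<or> m = 2 * real k1" by auto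
  qed
  have sub': "A \<subseteq> block 0" "B \<subseteq> block 1" "C \<subseteq> block 2" "D \<subseteq> block 0"
    using sub blocks colour_iff unfolding block_def by blast+
  have "card (F2 X A B C D) = card (pyramids A B C D)"
    unfolding pyramids_def by (rule card_F2) (use sub blocks disj in auto)
  moreover have "err = 2 * (real k1)\<^sup>2 * mu0 / (2 * real h) + (real k1 + mu1) * mu1"
    by (simp add: err_def h_def)
  ultimately show ?thesis
    using pyramids_estimate[OF sub' disj(3)]
    unfolding Let_def h_def[symmetric] n_def of_nat_mult of_nat_power of_nat_numeral k0
    by simp
qed

end
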